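(* Let $n,k,r$ be positive integers and let $T$ be a tree with $k$ edges which is not a star. If $r\ge k(k-2)$, then every $n$-vertex $r$-uniform (simple) hypergraph containing no Berge copy of $T$ has at most $\frac{n(k-1)}{r+1}$ hyperedges, i.e. $\mathrm{ex}_r(n,\mathcal{B}T)\le\frac{n(k-1)}{r+1}$. Equality holds (for a $T$-Berge-free $n$-vertex $r$-uniform hypergraph $\mathcal{H}$) if and only if $r+1$ divides $n$ and $\mathcal{H}$ is obtained by partitioning the vertex set into $\frac{n}{r+1}$ disjoint sets of size $r+1$ and taking, inside each of these sets, $k-1$ hyperedges (of size $r$); except when $k$ is odd and $T$ is the balanced double star, in which case equality holds if and only if $r+1$ divides $n$ and $\mathcal{H}$ is the vertex-disjoint union of sets of size $r+1$ each containing $k-1$ hyperedges and possibly a $(k-1,\frac{k-1}{2})$-regular two-sided $r$-uniform hypergraph.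
   Context: A hypergraph is $r$-uniform if every hyperedge has exactly $r$ vertices; hypergraphs here are simple (no repeated hyperedges). For a graph $G$, an $r$-uniform hypergraph $\mathcal{H}$ is a Berge copy of $G$ if there is an injection $f_1:V(G)\to V(\mathcal{H})$ and a bijection $f_2:E(G)\to E(\mathcal{H})$ such that $\{f_1(v_1),f_1(v_2)\}\subseteq f_2(\{v_1,v_2\})$ for every edge $\{v_1,v_2\}$ of $G$; $\mathcal{H}$ contains a Berge copy of $G$ if some sub-hypergraph of it is a Berge copy of $G$. $\mathrm{ex}_r(n,\mathcal{B}T)$ is the maximum number of hyperedges in an $n$-vertex $r$-uniform hypergraph containing no Berge copy of $T$. A star is a tree in which one vertex is incident to all edges. For odd $k$, the balanced double star with $k$ edges is the tree obtained from a single edge by attaching $\frac{k-1}{2}$ new pendant edges to each of its two endpoints. An $r$-uniform hypergraph is two-sided if its vertex set can be partitioned into a set $X$ and pairwise disjoint sets $A_1,\dots,A_t$ (disjoint from $X$), each of size $r-1$, such that every hyperedge has the form $\{x\}\cup A_i$ for some $x\in X$ and some $i$; it is $(a,b)$-regular if every vertex of $X$ has degree $a$ and every vertex of $\bigcup_i A_i$ has degree $b$.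
   Formalization: In the exceptional case the two degrees are swapped: vertices of X have degree (k-1)/2 and vertices of the sets A_i have degree k-1; with the order as printed the two-sided hypergraph has too few hyperedges for equality (e.g. k=3, disjoint pairs of edges sharing one vertex). *)

theory Defs
  imports Complex_Main "HOL-Library.Disjoint_Sets"
begin

text \<open>Finite simple graphs are given by a vertex set and a set of two-element edges.\<close>

definition simple_graph :: "'v set \<Rightarrow> 'v set set \<Rightarrow> bool" where
  "simple_graph V E \<longleftrightarrow> finite V \<and> (\<forall>e\<in>E. e \<subseteq> V \<and> card e = 2)"

definition connected_graph :: "'v set \<Rightarrow> 'v set set \<Rightarrow> bool" where
  "connected_graph V E \<longleftrightarrow> V \<noteq> {} \<and> (\<forall>u\<in>V. \<forall>v\<in>V. (u, v) \<in> {(x, y). {x, y} \<in> E}\<^sup>*)"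

definition graph_cycle :: "'v set set \<Rightarrow> 'v list \<Rightarrow> bool" where
  "graph_cycle E p \<longleftrightarrow> length p \<ge> 3 \<and> distinct p \<and>
     (\<forall>i<length p. {p ! i, p ! (Suc i mod length p)} \<in> E)"

definition tree :: "'v set \<Rightarrow> 'v set set \<Rightarrow> bool" where
  "tree V E \<longleftrightarrow> simple_graph V E \<and> connected_graph V E \<and> (\<nexists>p. graph_cycle E p)"

definition star :: "'v set \<Rightarrow> 'v set set \<Rightarrow> bool" where
  "star V E \<longleftrightarrow> tree V E \<and> (\<exists>c\<in>V. \<forall>e\<in>E. c \<in> e)"

text \<open>\<open>m\<close> is the number of pendant edges at each centre, so there are \<open>2 * m + 1\<close> edges in total.\<close>

definition balanced_double_star :: "nat \<Rightarrow> 'v set \<Rightarrow> 'v set set \<Rightarrow> bool" where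
  "balanced_double_star m V E \<longleftrightarrow>
     (\<exists>u v L M. u \<noteq> v \<and> finite L \<and> finite M \<and> card L = m \<and> card M = m \<and>
        L \<inter> M = {} \<and> {u, v} \<inter> (L \<union> M) = {} \<and>
        V = {u, v} \<union> L \<union> M \<and>
        E = {{u, v}} \<union> (\<lambda>x. {u, x}) ` L \<union> (\<lambda>y. {v, y}) ` M)"

definition hypergraph :: "'a set \<Rightarrow> 'a set set \<Rightarrow> bool" where
  "hypergraph V E \<longleftrightarrow> finite V \<and> (\<forall>e\<in>E. e \<subseteq> V)"

definition uniform_hypergraph :: "nat \<Rightarrow> 'a set \<Rightarrow> 'a set set \<Rightarrow> bool" where
  "uniform_hypergraph r V E \<longleftrightarrow> hypergraph V E \<and> (\<forall>e\<in>E. card e = r)"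

definition berge_copy :: "'v set \<Rightarrow> 'v set set \<Rightarrow> 'a set \<Rightarrow> 'a set set \<Rightarrow> bool" where
  "berge_copy VG EG V E \<longleftrightarrow>
     (\<exists>f1 f2. inj_on f1 VG \<and> f1 ` VG \<subseteq> V \<and> bij_betw f2 EG E \<and> (\<forall>e\<in>EG. f1 ` e \<subseteq> f2 e))"

definition contains_berge :: "'a set \<Rightarrow> 'a set set \<Rightarrow> 'v set \<Rightarrow> 'v set set \<Rightarrow> bool" where
  "contains_berge V E VG EG \<longleftrightarrow>
     (\<exists>V' E'. V' \<subseteq> V \<and> E' \<subseteq> E \<and> hypergraph V' E' \<and> berge_copy VG EG V' E')"

text \<open>The extremal number. The maximum is over a finite set, which is nonempty as soon as the
  forbidden graph has an edge.\<close>

definition ex_berge :: "nat \<Rightarrow> nat \<Rightarrow> 'v set \<Rightarrow> 'v set set \<Rightarrow> nat" where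
  "ex_berge r n VG EG =
     Max {card E | E. uniform_hypergraph r {..<n} E \<and> \<not> contains_berge {..<n} E VG EG}"

definition hdegree :: "'a set set \<Rightarrow> 'a \<Rightarrow> nat" where
  "hdegree E v = card {e \<in> E. v \<in> e}"

definition two_sided_with :: "nat \<Rightarrow> 'a set \<Rightarrow> 'a set set \<Rightarrow> 'a set \<Rightarrow> 'a set set \<Rightarrow> bool" where
  "two_sided_with r V E X \<A> \<longleftrightarrow>
     V = X \<union> \<Union>\<A> \<and> X \<inter> \<Union>\<A> = {} \<and> disjoint \<A> \<and> (\<forall>A\<in>\<A>. card A = r - 1) \<and>
     (\<forall>e\<in>E. \<exists>x\<in>X. \<exists>A\<in>\<A>. e = {x} \<union> A)"

text \<open>An \<open>(a, b)\<close>-regular two-sided \<open>r\<close>-uniform hypergraph. Counting edges gives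
  \<open>a * card X = b * card \<A>\<close>, hence it has
  \<open>card V * a * b / (b + a * (r - 1))\<close> edges. For this to be \<open>card V * m / (r + 1)\<close> with
  \<open>{a, b} = {m, m / 2}\<close> and \<open>r > 2\<close>, one needs \<open>a = m / 2\<close> and \<open>b = m\<close>. The empty hypergraph on no
  vertices is included.\<close>

definition regular_two_sided :: "nat \<Rightarrow> nat \<Rightarrow> nat \<Rightarrow> 'a set \<Rightarrow> 'a set set \<Rightarrow> bool" where
  "regular_two_sided r a b V E \<longleftrightarrow> uniform_hypergraph r V E \<and>
     (\<exists>X \<A>. two_sided_with r V E X \<A> \<and>
        (\<forall>x\<in>X. hdegree E x = a) \<and> (\<forall>v\<in>\<Union>\<A>. hdegree E v = b))"

definition block_hypergraph :: "nat \<Rightarrow> nat \<Rightarrow> 'a set \<Rightarrow> 'a set set \<Rightarrow> bool" where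
  "block_hypergraph r m V E \<longleftrightarrow> uniform_hypergraph r V E \<and>
     (\<exists>P. partition_on V P \<and> (\<forall>B\<in>P. card B = r + 1 \<and> card {e \<in> E. e \<subseteq> B} = m) \<and>
        (\<forall>e\<in>E. \<exists>B\<in>P. e \<subseteq> B))"

definition block_two_sided_union ::
    "nat \<Rightarrow> nat \<Rightarrow> nat \<Rightarrow> nat \<Rightarrow> 'a set \<Rightarrow> 'a set set \<Rightarrow> bool" where
  "block_two_sided_union r m a b V E \<longleftrightarrow>
     (\<exists>V1 V2 E1 E2. V = V1 \<union> V2 \<and> V1 \<inter> V2 = {} \<and> E = E1 \<union> E2 \<and>
        block_hypergraph r m V1 E1 \<and> regular_two_sided r a b V2 E2)"

end

(* Give a hyperedge f the weight sum_{v in f} 1/d(v); the total weight is at most n, so it is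
   enough that hyperedges weigh at least (r+1)/(k-1) on average.

   Consider the largest family F of hyperedges in which every member contains at least k-1 vertices
   of F-degree at least k-1. Outside F, hyperedges can be peeled off so that each of them meets at
   least r-k+2 vertices of current degree at most k-2; their average weight exceeds (r-k+2)/(k-2),
   which is at least (r+1)/(k-1) exactly when r >= k(k-2).

   Inside F, embed T greedily with its inner vertices at the heavy vertices. Since T is not a star,
   failure at the last edge forces F to split into classes C of k-1 hyperedges, each class being the
   set of all hyperedges at any of at least k-1 common vertices. Let z be a vertex of T all of whose
   neighbours but one are leaves, with 2 deg z <= k+1. If a vertex of a hyperedge of C also lies in a
   hyperedge outside C, placing z there shows that it has degree at most deg z - 1 <= (k-1)/2.
   Hence every class weighs at least r+1. Equality means that the class spans a component with r+1
   vertices, or that its hyperedges are obtained from a common (r-1)-set by adding single vertices of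
   degree (k-1)/2; the latter needs 2 deg z = k+1, and z can be chosen with 2 deg z <= k unless T is
   a balanced double star. *)
theory Submission
  imports Defs
begin

section \<open>Paths and growth in trees\<close>

text \<open>The target average \<open>(r+1)/(k-1)\<close> is that of an extremal block, where
  \<open>k-1\<close> hyperedges carry the weight of \<open>r+1\<close> vertices. The threshold
  \<open>k-1\<close> fits the embedding twice: a tree other than a star has at most
  \<open>k-1\<close> inner vertices, so a hyperedge with \<open>k-1\<close> heavy vertices has a
  free one for the next of them; and \<open>k-1\<close> hyperedges at a heavy vertex suffice for all
  edges but the last. Leaves wait until the end and are filled in from the large hyperedges; only
  \<open>k = r = 3\<close> is too tight for a greedy choice. Candidates for \<open>z\<close> lie
  next to the two ends of a longest path. They share at most one edge, so their degrees sum to at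
  most \<open>k+1\<close>. A class gets its weight as follows. A hyperedge with an outgoing vertex
  weighs at least \<open>(r-2+1)/(k-1) + 2/(k-1)\<close>; a class without outgoing vertices weighs
  as much as it has vertices; a mixture exceeds \<open>r+1\<close>. The obstacle is that weights use
  degrees in the whole hypergraph, while peeling only controls degrees outside \<open>F\<close>. The
  bound on outgoing vertices bridges this: a vertex on both sides has degree at most
  \<open>(k-1)/2\<close>, hence at most \<open>k-2\<close>.\<close>

abbreviation incident :: "'a set set \<Rightarrow> 'a \<Rightarrow> 'a set set" where
  "incident E v \<equiv> {e \<in> E. v \<in> e}"

definition graph_path :: "'v set set \<Rightarrow> 'v list \<Rightarrow> bool" where
  "graph_path E p \<longleftrightarrow> p \<noteq> [] \<and> distinct p \<and> successively (\<lambda>x y. {x, y} \<in> E) p"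

lemma graph_path_closing_edge:
  assumes p: "graph_path E p" and j: "2 \<le> j" "j < length p" and e: "{p ! 0, p ! j} \<in> E"
  shows "graph_cycle E (take (Suc j) p)"
  unfolding graph_cycle_def
proof (intro conjI allI impI)
  show "3 \<le> length (take (Suc j) p)" using j by simp
  show "distinct (take (Suc j) p)" using p by (simp add: graph_path_def)
  fix i assume "i < length (take (Suc j) p)"
  hence i: "i \<le> j" using j by simp
  show "{take (Suc j) p ! i, take (Suc j) p ! (Suc i mod length (take (Suc j) p))} \<in> E"
  proof (cases "i = j")
    case True
    moreover have "length (take (Suc j) p) = Suc j" using j by simp
    ultimately show ?thesis using e j by (simp only: mod_self) (simp add: insert_commute)
  next
    case False
    with i j have l: "Suc i < length p" "Suc i \<le> j" by auto
    have "{p ! i, p ! Suc i} \<in> E"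
      using p l(1) unfolding graph_path_def successively_conv_nth by blast
    thus ?thesis using l j by (simp add: min_def)
  qed
qed

text \<open>A walk that returns to a vertex already on the path is cut back to that vertex. The
  bound on \<open>set p\<close> confines the path to the vertex set when \<open>E\<close> consists
  of the edges induced on it.\<close>

lemma reachable_imp_graph_path:
  assumes "(a, b) \<in> {(x, y). {x, y} \<in> E}\<^sup>*"
  obtains p where "graph_path E p" "hd p = a" "last p = b" "set p \<subseteq> insert a (\<Union>E)"
proof -
  have "\<exists>p. graph_path E p \<and> hd p = a \<and> last p = b \<and> set p \<subseteq> insert a (\<Union>E)"
    using assms
  proof (induction rule: rtrancl_induct)
    case base
    show ?case by (rule exI[of _ "[a]"]) (simp add: graph_path_def)
  next
    case (step y z)
    then obtain p where p: "graph_path E p" "hd p = a" "last p = y" "set p \<subseteq> insert a (\<Union>E)"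
      by blast
    show ?case
    proof (cases "z \<in> set p")
      case True
      then obtain xs ys where "p = xs @ z # ys" by (meson split_list)
      with p show ?thesis
        by (intro exI[of _ "xs @ [z]"])
           (auto simp: graph_path_def successively_append_iff hd_append)
    next
      case False
      with p step show ?thesis
        by (intro exI[of _ "p @ [z]"])
           (auto simp: graph_path_def successively_append_iff)
    qed
  qed
  thus thesis using that by blast
qed

lemma graph_path_rev: "graph_path E p \<Longrightarrow> graph_path E (rev p)"
  by (simp add: graph_path_def insert_commute)

lemma graph_path_subset:
  assumes "graph_path E p" "E \<subseteq> F" shows "graph_path F p"
  using assms unfolding graph_path_def successively_conv_nth by blast

lemma connected_graph_insert:
  assumes "connected_graph S D" "a \<in> S"
  shows "connected_graph (insert b S) (insert {a, b} D)"
proof -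
  let ?R = "\<lambda>D. {(x, y). {x, y} \<in> D}"
  have mono: "(?R D)\<^sup>* \<subseteq> (?R (insert {a, b} D))\<^sup>*" by (intro rtrancl_mono) auto
  have old: "(u, v) \<in> (?R (insert {a, b} D))\<^sup>*" if "u \<in> S" "v \<in> S" for u v
    using assms that mono unfolding connected_graph_def by blast
  have ab: "(a, b) \<in> ?R (insert {a, b} D)" "(b, a) \<in> ?R (insert {a, b} D)"
    by (auto simp: insert_commute)
  have toa: "(u, a) \<in> (?R (insert {a, b} D))\<^sup>*" "(a, u) \<in> (?R (insert {a, b} D))\<^sup>*"
    if "u \<in> insert b S" for u
    using that old assms(2) ab by auto
  show ?thesis
    unfolding connected_graph_def using toa by (blast intro: rtrancl_trans)
qed

lemma connected_graph_boundary:
  assumes "connected_graph V E" "S \<subseteq> V" "S \<noteq> {}" "S \<noteq> V" "\<Union>E \<subseteq> V"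
  obtains a b where "a \<in> S" "b \<in> V" "b \<notin> S" "{a, b} \<in> E"
proof -
  obtain u v where u: "u \<in> S" and v: "v \<in> V" "v \<notin> S" using assms by blast
  have "(u, v) \<in> {(x, y). {x, y} \<in> E}\<^sup>*"
    using assms u v unfolding connected_graph_def by blast
  hence "v \<in> S \<or> (\<exists>a b. a \<in> S \<and> b \<notin> S \<and> {a, b} \<in> E)"
    by (induction rule: rtrancl_induct) (use u in blast)+
  with v assms(5) that show thesis by blast
qed

text \<open>Two edges from \<open>b\<close> into a connected set would close a cycle.\<close>

lemma acyclic_attach_unique:
  assumes "\<nexists>p. graph_cycle E p" "connected_graph S {e \<in> E. e \<subseteq> S}" "b \<notin> S"
    and "a \<in> S" "a' \<in> S" "{a, b} \<in> E" "{a', b} \<in> E"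
  shows "a = a'"
proof (rule ccontr)
  assume ne: "a \<noteq> a'"
  have "(a, a') \<in> {(x, y). {x, y} \<in> {e \<in> E. e \<subseteq> S}}\<^sup>*"
    using assms unfolding connected_graph_def by blast
  then obtain p where p: "graph_path {e \<in> E. e \<subseteq> S} p" "hd p = a" "last p = a'"
    "set p \<subseteq> insert a (\<Union>{e \<in> E. e \<subseteq> S})"
    by (rule reachable_imp_graph_path)
  have "set p \<subseteq> S" using p(4) assms(4) by auto
  hence b: "b \<notin> set p" using assms by blast
  have pE: "graph_path E p" by (rule graph_path_subset[OF p(1)]) auto
  have pne: "p \<noteq> []" using p by (simp add: graph_path_def)
  have len: "length p \<ge> 2"
    using p ne pne by (cases p; cases "tl p") auto
  have "graph_path E (b # p)"
    using pE b p assms by (auto simp: graph_path_def successively_Cons insert_commute)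
  moreover have "(b # p) ! length p = a'"
    using pne p by (simp add: last_conv_nth)
  ultimately have "graph_cycle E (take (Suc (length p)) (b # p))"
    using len assms(7) by (intro graph_path_closing_edge) (auto simp: insert_commute)
  with assms(1) show False by blast
qed

text \<open>Connectedness supplies an edge leaving \<open>S\<close>, and acyclicity makes it the
  only edge from its new endpoint \<open>b\<close> into \<open>S\<close>. Hence the induced edge set
  grows by exactly one edge, so extending an embedding costs one hyperedge and at most one new inner
  vertex. A base set \<open>B\<close> larger than a point allows an embedding to start from a
  prescribed piece.\<close>

lemma tree_grow_induct:
  assumes T: "tree V E" and B: "B \<subseteq> V" "connected_graph B {e \<in> E. e \<subseteq> B}"
    and base: "P B"
    and step: "\<And>S a b. \<lbrakk>B \<subseteq> S; S \<subseteq> V; connected_graph S {e \<in> E. e \<subseteq> S}; P S;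
      a \<in> S; b \<in> V; b \<notin> S; {a, b} \<in> E;
      {e \<in> E. e \<subseteq> insert b S} = insert {a, b} {e \<in> E. e \<subseteq> S}\<rbrakk> \<Longrightarrow> P (insert b S)"
  shows "P V"
proof -
  have fin: "finite V" and edges: "\<And>e. e \<in> E \<Longrightarrow> e \<subseteq> V \<and> card e = 2"
    and acyc: "\<nexists>p. graph_cycle E p" and conn: "connected_graph V E"
    using T by (auto simp: tree_def simple_graph_def)
  have "\<lbrakk>B \<subseteq> S; S \<subseteq> V; connected_graph S {e \<in> E. e \<subseteq> S}; P S\<rbrakk> \<Longrightarrow> P V" for S
  proof (induction "card (V - S)" arbitrary: S rule: less_induct)
    case less
    show ?case
    proof (cases "S = V")
      case True
      thus ?thesis using less by simp
    next
      case False
      have "S \<noteq> {}" using less.prems by (auto simp: connected_graph_def)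
      then obtain a b where ab: "a \<in> S" "b \<in> V" "b \<notin> S" "{a, b} \<in> E"
        using connected_graph_boundary[OF conn less.prems(2) _ False] edges by blast
      have D: "{e \<in> E. e \<subseteq> insert b S} = insert {a, b} {e \<in> E. e \<subseteq> S}"
      proof (intro equalityI subsetI)
        fix e assume e: "e \<in> {e \<in> E. e \<subseteq> insert b S}"
        show "e \<in> insert {a, b} {e \<in> E. e \<subseteq> S}"
        proof (cases "b \<in> e")
          case True
          obtain x y where xy: "e = {x, y}" "x \<noteq> y"
            using edges e by (metis (no_types, lifting) card_2_iff mem_Collect_eq)
          then obtain a' where a': "e = {a', b}" "a' \<noteq> b" using True by blast
          hence "a' \<in> S" using e by blast
          hence "a = a'"
            using acyclic_attach_unique[OF acyc less.prems(3) ab(3,1)] ab(4) a' e by blast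
          thus ?thesis using a' by simp
        qed (use e in blast)
      qed (use ab in auto)
      have "V - insert b S \<subset> V - S" using ab by blast
      hence lt: "card (V - insert b S) < card (V - S)" by (intro psubset_card_mono) (use fin in auto)
      show ?thesis
      proof (rule less.hyps[OF lt])
        show "connected_graph (insert b S) {e \<in> E. e \<subseteq> insert b S}"
          unfolding D by (rule connected_graph_insert[OF less.prems(3) ab(1)])
        show "P (insert b S)" using step less.prems ab D by blast
      qed (use less.prems ab in auto)
    qed
  qed
  thus ?thesis using B base by blast
qed

section \<open>Longest paths in acyclic graphs\<close>

definition longest_path :: "'v set set \<Rightarrow> 'v list \<Rightarrow> bool" where
  "longest_path E p \<longleftrightarrow> graph_path E p \<and> (\<forall>q. graph_path E q \<longrightarrow> length q \<le> length p)"

lemma longest_path_rev: "longest_path E p \<Longrightarrow> longest_path E (rev p)"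
  by (simp add: longest_path_def graph_path_rev)

lemma graph_path_subset_vertices:
  assumes "graph_path E p" "length p \<ge> 2" shows "set p \<subseteq> \<Union>E"
proof
  fix x assume "x \<in> set p"
  then obtain i where i: "i < length p" "x = p ! i" by (metis in_set_conv_nth)
  show "x \<in> \<Union>E"
  proof (cases "Suc i < length p")
    case True
    thus ?thesis using assms i unfolding graph_path_def successively_conv_nth by blast
  next
    case False
    then obtain j where j: "i = Suc j" using i assms by (cases i) auto
    hence "{p ! j, p ! i} \<in> E"
      using assms i unfolding graph_path_def successively_conv_nth by blast
    thus ?thesis using i by blast
  qed
qed

lemma longest_path_exists:
  assumes "simple_graph V E" "E \<noteq> {}"
  obtains p where "longest_path E p" "length p \<ge> 2"
proof -
  obtain e where "e \<in> E" using assms by blast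
  then obtain x y where "e = {x, y}" "x \<noteq> y"
    using assms by (metis card_2_iff simple_graph_def)
  hence xy: "graph_path E [x, y]" using \<open>e \<in> E\<close> by (simp add: graph_path_def)
  have bnd: "length q \<le> card V + 1" if "graph_path E q" for q
  proof (cases "length q \<ge> 2")
    case True
    have "set q \<subseteq> V"
      using graph_path_subset_vertices[OF that True] assms by (auto simp: simple_graph_def)
    hence "card (set q) \<le> card V" using assms by (intro card_mono) (auto simp: simple_graph_def)
    thus ?thesis using that by (simp add: graph_path_def distinct_card)
  qed auto
  let ?p = "ARG_MAX length p. graph_path E p"
  have b: "\<forall>y. graph_path E y \<longrightarrow> length y < card V + 2" using bnd by fastforce
  have "graph_path E ?p" "\<And>q. graph_path E q \<Longrightarrow> length q \<le> length ?p"
    using arg_max_nat_lemma[OF xy b] by auto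
  thus thesis using xy that[of ?p] unfolding longest_path_def by force
qed

text \<open>Another neighbour of the endpoint would prolong the path if it lies off the path, and
  close a cycle if it lies on it.\<close>

lemma longest_path_hd_leaf:
  assumes "\<nexists>p. graph_cycle E p" "longest_path E p" "length p \<ge> 2" "{p ! 0, w} \<in> E" "w \<noteq> p ! 0"
  shows "w = p ! 1"
proof (rule ccontr)
  assume ne: "w \<noteq> p ! 1"
  have p: "graph_path E p" using assms by (simp add: longest_path_def)
  show False
  proof (cases "w \<in> set p")
    case True
    then obtain i where "i < length p" "w = p ! i" by (metis in_set_conv_nth)
    moreover have "2 \<le> i" using ne assms calculation by (cases i; cases "i - 1") auto
    ultimately show False using graph_path_closing_edge[OF p] assms by blast
  next
    case False
    have "graph_path E (w # p)"
      using p False assms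
      by (auto simp: graph_path_def successively_Cons insert_commute hd_conv_nth)
    thus False using assms unfolding longest_path_def by fastforce
  qed
qed

text \<open>Makes every neighbour of \<open>p ! 1\<close> other than \<open>p ! 2\<close> an
  endpoint of some longest path, so that what holds at endpoints holds at all of them.\<close>

lemma longest_path_replace_hd:
  assumes "\<nexists>p. graph_cycle E p" "longest_path E p" "length p \<ge> 3" "{p ! 1, w} \<in> E"
    "w \<noteq> p ! 1" "w \<noteq> p ! 2"
  shows "longest_path E (w # tl p)"
proof (cases "w = p ! 0")
  case True
  hence "w # tl p = p" using assms by (cases p) auto
  thus ?thesis using assms by simp
next
  case False
  have p: "graph_path E p" using assms by (simp add: longest_path_def)
  have tl: "graph_path E (tl p)"
    using p assms(3) by (cases p) (auto simp: graph_path_def successively_Cons)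
  have nth: "tl p ! i = p ! Suc i" if "i < length p - 1" for i
    using that assms(3) by (cases p) auto
  have "w \<notin> set (tl p)"
  proof
    assume "w \<in> set (tl p)"
    then obtain i where i: "i < length (tl p)" "w = tl p ! i" by (metis in_set_conv_nth)
    have w: "w = p ! Suc i" using i nth by simp
    have "i \<noteq> 0" "i \<noteq> 1" using w assms(5,6) by (metis One_nat_def, metis Suc_1)
    hence "2 \<le> i" by simp
    moreover have "{tl p ! 0, tl p ! i} \<in> E" using assms(3,4) i nth by simp
    ultimately show False using graph_path_closing_edge[OF tl] i assms(1) by blast
  qed
  moreover have "hd (tl p) = p ! 1" using assms(3) by (cases p; cases "tl p") auto
  ultimately have "graph_path E (w # tl p)"
    using tl assms(4)
    by (auto simp: graph_path_def successively_Cons insert_commute)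
  moreover have "length (w # tl p) = length p" using assms by (cases p) auto
  ultimately show ?thesis using assms(2) unfolding longest_path_def by simp
qed

text \<open>These are the vertices whose images must lie in several hyperedges at once. An embedding
  places only them; leaves are filled in at the end.\<close>

definition inner :: "'v set \<Rightarrow> 'v set set \<Rightarrow> 'v set" where
  "inner V E = {v \<in> V. 2 \<le> hdegree E v}"

section \<open>Inner vertices, leaves and end vertices of a tree that is not a star\<close>

locale nonstar_tree =
  fixes V :: "'v set" and E :: "'v set set" and k :: nat
  assumes tree: "tree V E" and card_edges: "card E = k" and k_pos: "k > 0"
    and nonstar: "\<not> star V E"
begin

lemma fin_V: "finite V" and edge_subset: "e \<in> E \<Longrightarrow> e \<subseteq> V" and edge_card: "e \<in> E \<Longrightarrow> card e = 2"
  and acyclic: "\<nexists>p. graph_cycle E p" and connected: "connected_graph V E"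
  using tree by (auto simp: tree_def simple_graph_def)

lemma fin_E: "finite E"
  using k_pos card_edges card_ge_0_finite by blast

lemma fin_incident: "finite (incident E v)"
  using fin_E by simp

lemma edgeE:
  assumes "e \<in> E" "v \<in> e"
  obtains w where "e = {v, w}" "w \<noteq> v" "w \<in> V" "v \<in> V"
proof -
  obtain x y where "e = {x, y}" "x \<noteq> y" using edge_card[OF assms(1)] by (meson card_2_iff)
  thus thesis using assms that edge_subset[OF assms(1)]
    by (cases "v = x") (auto simp: insert_commute)
qed

lemma edge_neq: "{x, y} \<in> E \<Longrightarrow> x \<noteq> y"
  using edge_card by fastforce

lemma incident_eq: "incident E v = (\<lambda>w. {v, w}) ` {w. {v, w} \<in> E}"
proof (intro equalityI subsetI)
  fix e assume e: "e \<in> incident E v"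
  then obtain w where "e = {v, w}" using edgeE[of e v] by blast
  thus "e \<in> (\<lambda>w. {v, w}) ` {w. {v, w} \<in> E}" using e by blast
qed auto

lemma hdegree_ge_2I:
  assumes "e \<in> E" "e' \<in> E" "e \<noteq> e'" "v \<in> e" "v \<in> e'"
  shows "2 \<le> hdegree E v"
proof -
  have "card {e, e'} \<le> card (incident E v)"
    using assms by (intro card_mono fin_incident) auto
  thus ?thesis using assms by (simp add: hdegree_def)
qed

lemma hdegree_eq_1I:
  assumes "{v, w} \<in> E" "\<And>w'. {v, w'} \<in> E \<Longrightarrow> w' = w"
  shows "hdegree E v = 1"
proof -
  have "{w. {v, w} \<in> E} = {w}" using assms by blast
  hence "incident E v = {{v, w}}" by (subst incident_eq) simp
  thus ?thesis by (simp add: hdegree_def)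
qed

lemma hdegree_eq_1D:
  assumes "hdegree E v = 1" "e \<in> E" "e' \<in> E" "v \<in> e" "v \<in> e'"
  shows "e = e'"
  using assms hdegree_ge_2I[of e e' v] by fastforce

text \<open>Walks from \<open>c\<close> only alternate between \<open>c\<close> and its neighbours,
  so connectedness leaves no other vertices and every edge contains \<open>c\<close>.\<close>

lemma star_if_closed:
  assumes "c \<in> V" "\<And>w w'. {c, w} \<in> E \<Longrightarrow> {w, w'} \<in> E \<Longrightarrow> w' = c"
  shows False
proof -
  have nb: "a = c \<or> {c, a} \<in> E" if "a \<in> V" for a
  proof -
    have "(c, a) \<in> {(x, y). {x, y} \<in> E}\<^sup>*"
      using connected assms that by (auto simp: connected_graph_def)
    thus ?thesis
      by (induction rule: rtrancl_induct) (use assms(2) in auto)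
  qed
  have "c \<in> e" if "e \<in> E" for e
  proof -
    obtain a b where "e = {a, b}" using edge_card[OF \<open>e \<in> E\<close>] by (meson card_2_iff)
    thus ?thesis using nb[of a] assms(2)[of a b] that edge_subset[OF that] by auto
  qed
  hence "star V E" using tree assms(1) by (auto simp: star_def)
  thus False using nonstar by simp
qed

text \<open>On two or three vertices, every neighbour of \<open>p ! 1\<close> is an endpoint of a
  longest path and has \<open>p ! 1\<close> as its only neighbour, which makes the tree a
  star.\<close>

lemma longest_path_length:
  assumes p: "longest_path E p" "length p \<ge> 2"
  shows "length p \<ge> 4"
proof (rule ccontr)
  assume "\<not> ?thesis"
  hence l: "length p = 2 \<or> length p = 3" using p by auto
  have gp: "\<And>i. Suc i < length p \<Longrightarrow> {p ! i, p ! Suc i} \<in> E"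
    using p(1) unfolding longest_path_def graph_path_def successively_conv_nth by blast
  have e01: "{p ! 0, p ! 1} \<in> E" using gp[of 0] p by simp
  show False
  proof (rule star_if_closed)
    show "p ! 1 \<in> V" using e01 edge_subset by auto
    fix w w' assume w: "{p ! 1, w} \<in> E" "{w, w'} \<in> E"
    have r: "longest_path E (rev p)" by (rule longest_path_rev) fact
    from l show "w' = p ! 1"
    proof
      assume l2: "length p = 2"
      have "w = p ! 0"
        using longest_path_hd_leaf[OF acyclic r, of w] w edge_neq l2 by (auto simp: rev_nth)
      thus ?thesis using longest_path_hd_leaf[OF acyclic p(1), of w'] w edge_neq l2 by auto
    next
      assume l3: "length p = 3"
      show ?thesis
      proof (cases "w = p ! 2")
        case True
        thus ?thesis
          using longest_path_hd_leaf[OF acyclic r, of w'] w edge_neq l3 by (auto simp: rev_nth)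
      next
        case False
        have "longest_path E (w # tl p)"
          by (rule longest_path_replace_hd[OF acyclic p(1)])
            (use l3 w False edge_neq in auto)
        from longest_path_hd_leaf[OF acyclic this, of w'] show ?thesis
          using w edge_neq[OF w(2)] l3 by (cases p) auto
      qed
    qed
  qed
qed

text \<open>The vertex \<open>z\<close> of the overview, with \<open>y\<close> its one neighbour
  that is not a leaf. The degree condition on \<open>y\<close> makes \<open>{z, y}\<close> an edge
  between two inner vertices, hence not a pendant one.\<close>

definition end_vertex :: "'v \<Rightarrow> 'v \<Rightarrow> bool" where
  "end_vertex z y \<longleftrightarrow> {z, y} \<in> E \<and> 2 \<le> hdegree E z \<and> 2 \<le> hdegree E y \<and>
     (\<forall>w. {z, w} \<in> E \<longrightarrow> w \<noteq> y \<longrightarrow> hdegree E w = 1)"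

lemma longest_path_end_vertex:
  assumes p: "longest_path E p" "length p \<ge> 4"
  shows "end_vertex (p ! 1) (p ! 2)" "hdegree E (p ! 0) = 1" "p ! 0 \<in> V"
proof -
  have gp: "\<And>i. Suc i < length p \<Longrightarrow> {p ! i, p ! Suc i} \<in> E" and d: "distinct p"
    using p(1) unfolding longest_path_def graph_path_def successively_conv_nth by blast+
  have e: "{p ! 0, p ! 1} \<in> E" "{p ! 1, p ! 2} \<in> E" "{p ! 2, p ! 3} \<in> E"
    using gp[of 0] gp[of 1] gp[of 2] p by (auto simp: numeral_2_eq_2 numeral_3_eq_3)
  have ne: "p ! 0 \<noteq> p ! 2" "p ! 1 \<noteq> p ! 3" by (subst nth_eq_iff_index_eq[OF d]; use p(2) in linarith)+
  have leaf: "hdegree E (q ! 0) = 1" if "longest_path E q" "length q = length p" for q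
  proof (rule hdegree_eq_1I)
    show "{q ! 0, q ! 1} \<in> E"
      using that p unfolding longest_path_def graph_path_def successively_conv_nth by auto
    show "w' = q ! 1" if "{q ! 0, w'} \<in> E" for w'
      using longest_path_hd_leaf[OF acyclic \<open>longest_path E q\<close> _ that] edge_neq[OF that] p
        \<open>length q = length p\<close> by auto
  qed
  show "hdegree E (p ! 0) = 1" by (rule leaf) (use p in auto)
  show "p ! 0 \<in> V" using e edge_subset by auto
  show "end_vertex (p ! 1) (p ! 2)"
    unfolding end_vertex_def
  proof (intro conjI allI impI)
    show "{p ! 1, p ! 2} \<in> E" by fact
    show "2 \<le> hdegree E (p ! 1)" "2 \<le> hdegree E (p ! 2)"
      by (rule hdegree_ge_2I[OF e(1,2)], use ne in \<open>auto simp: doubleton_eq_iff\<close>)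
         (rule hdegree_ge_2I[OF e(2,3)], use ne in \<open>auto simp: doubleton_eq_iff\<close>)
    fix w assume w: "{p ! 1, w} \<in> E" "w \<noteq> p ! 2"
    have "longest_path E (w # tl p)"
      by (rule longest_path_replace_hd[OF acyclic p(1)]) (use p w edge_neq in auto)
    from leaf[OF this] show "hdegree E w = 1" using p by simp
  qed
qed

text \<open>A longest path and its reversal give one end vertex and one leaf each; since the path
  has at least four vertices, its second and second last vertices differ. The two leaves serve the
  bound on inner vertices.\<close>

lemma two_end_vertices:
  obtains z y z' y' l l' where "end_vertex z y" "end_vertex z' y'" "z \<noteq> z'"
    "l \<in> V" "l' \<in> V" "l \<noteq> l'" "hdegree E l = 1" "hdegree E l' = 1"
proof -
  have "E \<noteq> {}" using card_edges k_pos by auto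
  then obtain p where p: "longest_path E p" "length p \<ge> 2"
    using longest_path_exists tree unfolding tree_def by blast
  have l: "length p \<ge> 4" by (rule longest_path_length[OF p])
  have d: "distinct p" using p unfolding longest_path_def graph_path_def by blast
  hence ne: "p ! 1 \<noteq> rev p ! 1" "p ! 0 \<noteq> rev p ! 0" 
    by (subst rev_nth, use l in linarith, subst nth_eq_iff_index_eq[OF d]; use l in linarith)+
  show thesis
    using that[OF longest_path_end_vertex(1)[OF p(1) l]
      longest_path_end_vertex(1)[OF longest_path_rev[OF p(1)]] ne(1)
      longest_path_end_vertex(3)[OF p(1) l] longest_path_end_vertex(3)[OF longest_path_rev[OF p(1)]]
      ne(2) longest_path_end_vertex(2)[OF p(1) l]
      longest_path_end_vertex(2)[OF longest_path_rev[OF p(1)]]] l by simp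
qed

lemma incident_nonempty:
  assumes "v \<in> V" shows "1 \<le> hdegree E v"
proof -
  obtain z y where "{z, y} \<in> E" "z \<noteq> y"
    using two_end_vertices edge_neq unfolding end_vertex_def by metis
  then obtain u where u: "u \<in> V" "u \<noteq> v" using edge_subset by blast
  have "(v, u) \<in> {(x, y). {x, y} \<in> E}\<^sup>*"
    using connected assms u by (auto simp: connected_graph_def)
  then obtain w where "{v, w} \<in> E" using u(2) by (auto elim: converse_rtranclE)
  hence "incident E v \<noteq> {}" by auto
  hence "card (incident E v) > 0" using fin_incident card_gt_0_iff by blast
  thus ?thesis by (simp add: hdegree_def)
qed

lemma inner_subset: "inner V E \<subseteq> V"
  by (auto simp: inner_def)

lemma leaf_iff: "v \<in> V - inner V E \<longleftrightarrow> v \<in> V \<and> hdegree E v = 1"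
  using incident_nonempty[of v] by (auto simp: inner_def)

lemma edge_has_inner:
  assumes "e \<in> E" shows "e \<inter> inner V E \<noteq> {}"
proof
  assume emp: "e \<inter> inner V E = {}"
  obtain a b where ab: "e = {a, b}" "a \<noteq> b" using edge_card[OF assms] by (meson card_2_iff)
  have V: "a \<in> V" "b \<in> V" using ab edge_subset[OF assms] by auto
  have "hdegree E a = 1" "hdegree E b = 1" using leaf_iff[of a] leaf_iff[of b] emp ab V by auto
  hence "{a, w} \<in> E \<Longrightarrow> w = b" "{b, w} \<in> E \<Longrightarrow> w = a" for w
    using hdegree_eq_1D[of a "{a, w}" e] hdegree_eq_1D[of b "{b, w}" e] ab assms
    by (auto simp: doubleton_eq_iff)
  thus False using star_if_closed[of a] V by blast
qed

lemma sum_degrees: "(\<Sum>v\<in>V. hdegree E v) = 2 * k"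
  unfolding hdegree_def card_edges[symmetric]
proof (rule sum_multicount[OF fin_V fin_E], rule ballI)
  fix e assume "e \<in> E"
  hence "{v \<in> V. v \<in> e} = e" using edge_subset by auto
  thus "card {v \<in> V. v \<in> e} = 2" using edge_card[OF \<open>e \<in> E\<close>] by simp
qed

text \<open>In the degree sum \<open>2 * k\<close>, inner vertices count at least 2 each, and at
  least two leaves count 1 each. As two end vertices are inner, the resulting bound also forces
  \<open>3 \<le> k\<close>.\<close>

lemma card_inner: "card (inner V E) \<le> k - 1" and k_ge_3: "3 \<le> k"
proof -
  obtain z y z' y' l l' where ends: "end_vertex z y" "end_vertex z' y'" "z \<noteq> z'"
    and l: "l \<in> V" "l' \<in> V" "l \<noteq> l'" "hdegree E l = 1" "hdegree E l' = 1"
    by (rule two_end_vertices)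
  have fin: "finite (inner V E)" using fin_V inner_subset finite_subset by blast
  have leaves: "2 \<le> card (V - inner V E)"
  proof -
    have "{l, l'} \<subseteq> V - inner V E" using l by (auto simp: inner_def)
    hence "card {l, l'} \<le> card (V - inner V E)" using fin_V by (intro card_mono) auto
    thus ?thesis using l by simp
  qed
  have "2 * card (inner V E) + card (V - inner V E)
      \<le> (\<Sum>v\<in>inner V E. hdegree E v) + (\<Sum>v\<in>V - inner V E. hdegree E v)"
  proof (rule add_mono)
    show "2 * card (inner V E) \<le> (\<Sum>v\<in>inner V E. hdegree E v)"
      using sum_bounded_below[of "inner V E" 2 "hdegree E"] by (auto simp: inner_def)
    show "card (V - inner V E) \<le> (\<Sum>v\<in>V - inner V E. hdegree E v)"
      using sum_bounded_below[of "V - inner V E" 1 "hdegree E"] incident_nonempty by auto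
  qed
  also have "\<dots> = 2 * k"
    using sum_degrees sum.subset_diff[OF inner_subset fin_V, of "hdegree E"] by simp
  finally show inn: "card (inner V E) \<le> k - 1" using leaves by simp
  have "{z, z'} \<subseteq> inner V E"
    using ends edge_subset unfolding end_vertex_def inner_def by blast
  hence "card {z, z'} \<le> card (inner V E)" using fin by (intro card_mono)
  thus "3 \<le> k" using inn ends(3) by simp
qed

lemma end_vertexD:
  assumes "end_vertex z y"
  shows "{z, y} \<in> E" "z \<noteq> y" "z \<in> inner V E" "y \<in> inner V E" "2 \<le> hdegree E z" "2 \<le> hdegree E y"
proof -
  show zy: "{z, y} \<in> E" and d: "2 \<le> hdegree E z" "2 \<le> hdegree E y"
    using assms unfolding end_vertex_def by blast+
  show "z \<noteq> y" by (rule edge_neq[OF zy])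
  show "z \<in> inner V E" "y \<in> inner V E" using edge_subset[OF zy] d by (auto simp: inner_def)
qed

lemma leaf_edges:
  obtains d where "inj_on d (V - inner V E)" "\<And>v. v \<in> V - inner V E \<Longrightarrow> d v \<in> E \<and> v \<in> d v"
proof -
  have "\<exists>e. e \<in> E \<and> v \<in> e" if "v \<in> V - inner V E" for v
  proof -
    have "incident E v \<noteq> {}" using incident_nonempty[of v] that by (force simp: hdegree_def)
    thus ?thesis by blast
  qed
  then obtain d where d: "\<And>v. v \<in> V - inner V E \<Longrightarrow> d v \<in> E \<and> v \<in> d v" by metis
  moreover have "inj_on d (V - inner V E)"
  proof (rule inj_onI, rule ccontr)
    fix u v assume uv: "u \<in> V - inner V E" "v \<in> V - inner V E" "d u = d v" "u \<noteq> v"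
    hence "d u = {u, v}" using d[of u] d[of v] by (metis edgeE insert_iff singletonD)
    thus False using edge_has_inner[of "d u"] d[of u] uv by auto
  qed
  ultimately show thesis using that[of d] by blast
qed

text \<open>Distinct leaves have distinct pendant edges, and the edge between an end vertex and its
  inner neighbour is not among them.\<close>

lemma card_leaves: "card (V - inner V E) \<le> k - 1"
proof -
  obtain z y where zy: "end_vertex z y" using two_end_vertices by metis
  obtain d where d: "inj_on d (V - inner V E)" "\<And>v. v \<in> V - inner V E \<Longrightarrow> d v \<in> E \<and> v \<in> d v"
    using leaf_edges by metis
  have "card (V - inner V E) \<le> card (E - {{z, y}})"
  proof (rule card_inj_on_le[OF d(1)])
    have "{z, y} \<subseteq> inner V E" using end_vertexD[OF zy] by blast
    thus "d ` (V - inner V E) \<subseteq> E - {{z, y}}" using d(2) by blast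
    show "finite (E - {{z, y}})" using fin_E by simp
  qed
  thus ?thesis using end_vertexD(1)[OF zy] fin_E card_edges by simp
qed

text \<open>The two incidence sets share at most the edge \<open>{z, z'}\<close>, so the degrees sum
  to at most \<open>k + 1\<close>. The lower bounds make this tight: \<open>{z, z'}\<close> is an
  edge, both degrees equal \<open>(k + 1) / 2\<close>, and no edge avoids both vertices.\<close>

lemma balanced_double_star_if_ends:
  assumes "end_vertex z y" "end_vertex z' y'" "z \<noteq> z'"
    and deg: "k + 1 \<le> 2 * hdegree E z" "k + 1 \<le> 2 * hdegree E z'"
  shows "2 * hdegree E z = k + 1 \<and> balanced_double_star ((k - 1) div 2) V E"
proof -
  let ?I = "incident E z" and ?J = "incident E z'"
  have "?I \<inter> ?J \<subseteq> {{z, z'}}"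
  proof
    fix e assume e: "e \<in> ?I \<inter> ?J"
    then obtain w where "e = {z, w}" using edgeE[of e z] by blast
    thus "e \<in> {{z, z'}}" using e assms(3) by auto
  qed
  hence c1: "card (?I \<inter> ?J) \<le> 1" and c0: "?I \<inter> ?J = {} \<or> {z, z'} \<in> E"
    using card_mono[of "{{z, z'}}" "?I \<inter> ?J"] by auto
  have "card (?I \<union> ?J) \<le> k" using card_mono[OF fin_E, of "?I \<union> ?J"] card_edges by auto
  moreover have "card ?I + card ?J = card (?I \<union> ?J) + card (?I \<inter> ?J)"
    by (rule card_Un_Int) (use fin_E in auto)
  moreover have "k + 1 \<le> 2 * card ?I" "k + 1 \<le> 2 * card ?J"
    using deg by (simp_all add: hdegree_def)
  ultimately have c: "card (?I \<union> ?J) = k" "card (?I \<inter> ?J) = 1" "2 * card ?I = k + 1"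
    "2 * card ?J = k + 1" using c1 by linarith+
  have zz: "{z, z'} \<in> E" using c c0 by auto
  have un: "?I \<union> ?J = E" using card_subset_eq[OF fin_E, of "?I \<union> ?J"] c card_edges by auto
  have y: "y = z'" "y' = z"
    using assms zz unfolding end_vertex_def by (auto simp: insert_commute)
  define L where "L = {w. {z, w} \<in> E} - {z'}"
  define M where "M = {w. {z', w} \<in> E} - {z}"
  have cardN: "card {w. {u, w} \<in> E} = hdegree E u" for u
  proof -
    have "bij_betw (\<lambda>w. {u, w}) {w. {u, w} \<in> E} (incident E u)"
      unfolding bij_betw_def incident_eq by (auto simp: inj_on_def doubleton_eq_iff)
    thus ?thesis using bij_betw_same_card unfolding hdegree_def by blast
  qed
  have finN: "finite {w. {u, w} \<in> E}" for u
    by (rule finite_subset[OF _ fin_V]) (use edge_subset in blast)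
  have cL: "card L = (k - 1) div 2" "card M = (k - 1) div 2"
    using cardN[of z] cardN[of z'] c zz finN
    by (simp_all add: L_def M_def hdegree_def insert_commute)
  have leafL: "hdegree E w = 1" if "w \<in> L \<union> M" for w
    using that assms(1,2) y by (auto simp: L_def M_def end_vertex_def)
  have "L \<inter> M = {}"
  proof (rule ccontr)
    assume "\<not> ?thesis"
    then obtain w where w: "w \<in> L" "w \<in> M" by blast
    hence "{z, w} = {z', w}"
      using hdegree_eq_1D[OF leafL[of w], of "{z, w}" "{z', w}"] by (auto simp: L_def M_def)
    thus False using assms(3) by (auto simp: doubleton_eq_iff)
  qed
  moreover have "{z, z'} \<inter> (L \<union> M) = {}"
    using edge_neq[of z z] edge_neq[of z' z'] by (auto simp: L_def M_def)
  moreover have E: "E = {{z, z'}} \<union> (\<lambda>x. {z, x}) ` L \<union> (\<lambda>y. {z', y}) ` M"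
  proof (intro equalityI subsetI)
    fix e assume "e \<in> E"
    hence "e \<in> (\<lambda>w. {z, w}) ` {w. {z, w} \<in> E} \<union> (\<lambda>w. {z', w}) ` {w. {z', w} \<in> E}"
      using un incident_eq by blast
    thus "e \<in> {{z, z'}} \<union> (\<lambda>x. {z, x}) ` L \<union> (\<lambda>y. {z', y}) ` M"
      by (auto simp: L_def M_def insert_commute)
  qed (use zz in \<open>auto simp: L_def M_def\<close>)
  moreover have "V = {z, z'} \<union> L \<union> M"
  proof (intro equalityI subsetI)
    fix v assume "v \<in> V"
    hence "incident E v \<noteq> {}" using incident_nonempty[of v] by (force simp: hdegree_def)
    then obtain e where "e \<in> E" "v \<in> e" by blast
    thus "v \<in> {z, z'} \<union> L \<union> M" by (subst (asm) E) auto
  qed (use edge_subset zz in \<open>auto simp: L_def M_def\<close>)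
  moreover have "finite L" "finite M" using finN by (auto simp: L_def M_def)
  ultimately have "balanced_double_star ((k - 1) div 2) V E"
    unfolding balanced_double_star_def using cL assms(3) by blast
  thus ?thesis using c by (simp add: hdegree_def)
qed

lemma small_end_vertex:
  obtains z y where "end_vertex z y"
    "2 * hdegree E z \<le> k \<or> 2 * hdegree E z = k + 1 \<and> balanced_double_star ((k - 1) div 2) V E"
proof -
  obtain z y z' y' where "end_vertex z y" "end_vertex z' y'" "z \<noteq> z'"
    by (rule two_end_vertices)
  thus thesis
    using that balanced_double_star_if_ends[of z y z' y'] by fastforce
qed

end

section \<open>Embedding the tree\<close>

lemma greedy_representatives:
  assumes "finite L" "finite P" "\<And>v. v \<in> L \<Longrightarrow> finite (F v) \<and> card P + card L \<le> card (F v)"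
  shows "\<exists>q. inj_on q L \<and> (\<forall>v\<in>L. q v \<in> F v - P)"
  using assms(1,3)
proof (induction L rule: finite_induct)
  case (insert v L)
  have "\<And>u. u \<in> L \<Longrightarrow> finite (F u) \<and> card P + card L \<le> card (F u)"
    using insert.prems insert.hyps by fastforce
  then obtain q where q: "inj_on q L" "\<forall>u\<in>L. q u \<in> F u - P" using insert.IH by blast
  have "card (P \<union> q ` L) \<le> card P + card L"
    by (meson card_Un_le card_image_le insert.hyps(1) add_left_mono le_trans)
  also have "\<dots> < card (F v)" using insert.prems[of v] insert.hyps by simp
  finally have "\<not> F v \<subseteq> P \<union> q ` L"
    using card_mono[of "P \<union> q ` L" "F v"] assms(2) insert.hyps(1) by force
  then obtain b where b: "b \<in> F v" "b \<notin> P" "b \<notin> q ` L" by blast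
  show ?case
  proof (intro exI conjI)
    show "inj_on (q(v := b)) (insert v L)"
      using q(1) b(3) insert.hyps by (auto simp: inj_on_def)
    show "\<forall>u\<in>insert v L. (q(v := b)) u \<in> F u - P" using q b by auto
  qed
qed auto

text \<open>Serves \<open>k = r = 3\<close>, where two leaves must avoid two occupied vertices in
  hyperedges of size 3 and the greedy count falls one short. Distinctness of the hyperedges rescues
  it: if a single vertex \<open>a\<close> were the only choice for both, each would equal
  \<open>insert a P\<close>.\<close>

lemma two_representatives:
  assumes "card L \<le> 2" "finite L" "card P \<le> 2" "finite P" "inj_on F L"
    and F: "\<And>v. v \<in> L \<Longrightarrow> card (F v) = 3"
  shows "\<exists>q. inj_on q L \<and> (\<forall>v\<in>L. q v \<in> F v - P)"
proof (cases "card L = 2")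
  have finF: "finite (F v)" if "v \<in> L" for v
    using F[OF that] by (metis card.infinite zero_neq_numeral)
  case False
  hence "card P + card L \<le> 3" using assms by linarith
  hence "finite (F v) \<and> card P + card L \<le> card (F v)" if "v \<in> L" for v
    using F[OF that] finF[OF that] by simp
  thus ?thesis by (rule greedy_representatives[OF assms(2,4)])
next
  case True
  then obtain u v where L: "L = {u, v}" "u \<noteq> v" by (meson card_2_iff)
  have ne: "F u \<noteq> F v" using assms(5) L by (auto simp: inj_on_def)
  have "F u - P \<noteq> {}" "F v - P \<noteq> {}"
    using card_mono[OF assms(4), of "F u"] card_mono[OF assms(4), of "F v"] F[of u] F[of v]
      L(1) assms(3) by (auto simp: Diff_eq_empty_iff)
  then obtain a b where ab: "a \<in> F u - P" "b \<in> F v - P" by blast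
  have "\<exists>a b. a \<in> F u - P \<and> b \<in> F v - P \<and> a \<noteq> b"
  proof (rule ccontr)
    assume neg: "\<not> ?thesis"
    hence sub: "F u \<subseteq> insert a P" "F v \<subseteq> insert a P" using ab by blast+
    have "card (insert a P) \<le> 3" using assms(3,4) by (simp add: card_insert_if)
    hence "F u = insert a P" "F v = insert a P"
      using card_seteq[of "insert a P"] sub F[of u] F[of v] L assms(4) by auto
    thus False using ne by simp
  qed
  then obtain a b where "a \<in> F u - P" "b \<in> F v - P" "a \<noteq> b" by blast
  thus ?thesis
    using L by (intro exI[of _ "(\<lambda>_. b)(u := a)"]) auto
qed

section \<open>Completing an embedding of the inner vertices\<close>

locale berge_free = nonstar_tree V E k
  for V :: "'v set" and E :: "'v set set" and k :: nat +
  fixes r :: nat and X :: "'a set" and H :: "'a set set"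
  assumes uniform: "uniform_hypergraph r X H"
    and berge_free: "\<not> contains_berge X H V E"
    and r_ge: "k * (k - 2) \<le> r"
begin

lemma fin_X: "finite X" and hyperedge_subset: "f \<in> H \<Longrightarrow> f \<subseteq> X"
  and hyperedge_card: "f \<in> H \<Longrightarrow> card f = r"
  using uniform by (auto simp: uniform_hypergraph_def hypergraph_def)

lemma fin_H: "finite H"
  by (rule finite_subset[of _ "Pow X"]) (use hyperedge_subset fin_X in auto)

lemma fin_hyperedge: "f \<in> H \<Longrightarrow> finite f"
  using hyperedge_subset fin_X finite_subset by blast

lemma r_ge_3: "3 \<le> r"
proof -
  have "3 * 1 \<le> k * (k - 2)" using k_ge_3 by (intro mult_le_mono) auto
  thus ?thesis using r_ge by simp
qed

text \<open>A leaf lies in one edge only, and the hyperedge of that edge has \<open>r\<close>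
  vertices, of which inner images take at most \<open>k - 1\<close> and other leaves at most
  \<open>k - 2\<close>. So placing the inner vertices and choosing distinct hyperedges already
  yields a Berge copy.\<close>

lemma no_skeleton:
  assumes g: "inj_on g (inner V E)" and h: "inj_on h E" "h ` E \<subseteq> H"
    and gh: "\<And>e. e \<in> E \<Longrightarrow> g ` (e \<inter> inner V E) \<subseteq> h e"
  shows False
proof -
  let ?I = "inner V E" and ?L = "V - inner V E"
  obtain d where d: "inj_on d ?L" "\<And>v. v \<in> ?L \<Longrightarrow> d v \<in> E \<and> v \<in> d v" using leaf_edges by metis
  have finI: "finite ?I" using inner_subset fin_V finite_subset by blast
  have cP: "card (g ` ?I) \<le> k - 1" using card_image_le[OF finI, of g] card_inner by linarith
  have F: "card (h (d v)) = r" "finite (h (d v))" if "v \<in> ?L" for v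
    using d(2)[OF that] h(2) hyperedge_card fin_hyperedge by (auto simp: image_subset_iff)
  have "\<exists>q. inj_on q ?L \<and> (\<forall>v\<in>?L. q v \<in> h (d v) - g ` ?I)"
  proof (cases "2 * k - 2 \<le> r")
    case True
    have "card (g ` ?I) + card ?L \<le> r" using cP card_leaves True by linarith
    hence "finite (h (d v)) \<and> card (g ` ?I) + card ?L \<le> card (h (d v))" if "v \<in> ?L" for v
      using F[OF that] by simp
    thus ?thesis using fin_V finI by (intro greedy_representatives) simp_all
  next
    case False
    \<comment> \<open>From \<open>k = 4\<close> on, \<open>k * (k - 2)\<close> is at least
      \<open>2 * k\<close>; only \<open>k = 3\<close> leaves room below \<open>2 * k - 2\<close>,
      and there \<open>r\<close> must be 3.\<close>
    have k: "k = 3"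
    proof (rule ccontr)
      assume "k \<noteq> 3"
      hence "2 \<le> k - 2" using k_ge_3 by simp
      hence "k * 2 \<le> k * (k - 2)" by (rule mult_le_mono2)
      thus False using r_ge False by linarith
    qed
    hence "r = 3" using False r_ge by simp
    have "inj_on (\<lambda>v. h (d v)) ?L"
      using comp_inj_on[OF d(1), of h] inj_on_subset[OF h(1), of "d ` ?L"] d(2)
      by (auto simp: comp_def)
    moreover have "card ?L \<le> 2" "card (g ` ?I) \<le> 2" using k cP card_leaves by auto
    moreover have "card (h (d v)) = 3" if "v \<in> ?L" for v using F[OF that] \<open>r = 3\<close> by simp
    ultimately show ?thesis using fin_V finI by (intro two_representatives) simp_all
  qed
  then obtain q where q: "inj_on q ?L" "\<And>v. v \<in> ?L \<Longrightarrow> q v \<in> h (d v) - g ` ?I" by blast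
  define f1 where "f1 v = (if v \<in> ?I then g v else q v)" for v
  have in_edge: "f1 v \<in> h e" if "e \<in> E" "v \<in> e" for e v
  proof (cases "v \<in> ?I")
    case True
    thus ?thesis using gh that by (auto simp: f1_def)
  next
    case False
    hence v: "v \<in> ?L" using that edge_subset by blast
    hence "d v = e" using hdegree_eq_1D[of v "d v" e] leaf_iff[of v] d(2)[OF v] that by blast
    thus ?thesis using q(2)[OF v] False by (simp add: f1_def)
  qed
  have "f1 v \<in> X" if "v \<in> V" for v
  proof -
    have "incident E v \<noteq> {}" using incident_nonempty[of v] that by (force simp: hdegree_def)
    then obtain e where "e \<in> E" "v \<in> e" by blast
    thus ?thesis using in_edge h(2) hyperedge_subset by blast
  qed
  moreover have "inj_on f1 V"
  proof (rule inj_onI)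
    fix u v assume uv: "u \<in> V" "v \<in> V" "f1 u = f1 v"
    have mem: "f1 a \<in> g ` ?I \<longleftrightarrow> a \<in> ?I" if "a \<in> V" for a
      using q(2)[of a] that by (auto simp: f1_def)
    show "u = v"
    proof (cases "u \<in> ?I")
      case True
      hence "v \<in> ?I" using mem uv by metis
      thus ?thesis using inj_onD[OF g, of u v] True uv by (simp add: f1_def)
    next
      case False
      hence "v \<notin> ?I" using mem uv by metis
      thus ?thesis using inj_onD[OF q(1), of u v] False uv by (simp add: f1_def)
    qed
  qed
  moreover have "bij_betw h E (h ` E)" using h(1) by (simp add: bij_betw_def)
  ultimately have "berge_copy V E X (h ` E)"
    unfolding berge_copy_def using in_edge by blast
  moreover have "hypergraph X (h ` E)"
    using h(2) hyperedge_subset fin_X by (auto simp: hypergraph_def)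
  ultimately have "contains_berge X H V E"
    unfolding contains_berge_def using h(2) by blast
  thus False using berge_free by simp
qed

text \<open>Otherwise \<open>z\<close> fits at \<open>p\<close>: its edges use
  \<open>hdegree E z\<close> hyperedges at \<open>p\<close>, including \<open>f\<close> and
  \<open>f'\<close>. All other inner vertices go into \<open>A\<close>, where any remaining
  hyperedge of \<open>C\<close> can serve any remaining edge.\<close>

lemma outgoing_hdegree_less:
  assumes z: "end_vertex z y"
    and C: "C \<subseteq> H" "card C = k - 1"
    and A: "finite A" "k - 1 \<le> card A" "\<And>f. f \<in> C \<Longrightarrow> A \<subseteq> f"
    and p: "p \<notin> A" "f \<in> C" "p \<in> f" "f' \<in> H" "f' \<notin> C" "p \<in> f'"
  shows "hdegree H p < hdegree E z"
proof (rule ccontr)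
  assume "\<not> ?thesis"
  hence ge: "hdegree E z \<le> card (incident H p)" by (simp add: hdegree_def)
  have finI: "finite (inner V E)" using inner_subset fin_V finite_subset by blast
  have finC: "finite C" using C fin_H finite_subset by blast
  note zy = end_vertexD(1)[OF z] and zI = end_vertexD(3)[OF z] and yI = end_vertexD(4)[OF z]
    and z2 = end_vertexD(5)[OF z]
  have "f \<noteq> f'" using p by blast
  hence "card {f, f'} \<le> hdegree E z" using z2 by simp
  then obtain Q where Q: "{f, f'} \<subseteq> Q" "Q \<subseteq> incident H p" "card Q = hdegree E z"
    using exists_subset_between[of "{f, f'}" "hdegree E z" "incident H p"] ge p C fin_H by auto
  have finQ: "finite Q" using Q fin_H by (auto intro: finite_subset[OF Q(2)])
  have "card (incident E z - {{z, y}}) = hdegree E z - 1" "card (Q - {f}) = hdegree E z - 1"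
    using zy Q by (simp_all add: card_Diff_singleton hdegree_def)
  hence "card (incident E z - {{z, y}}) = card (Q - {f})" by simp
  then obtain \<phi> where \<phi>: "bij_betw \<phi> (incident E z - {{z, y}}) (Q - {f})"
    using bij_betw_iff_card[of "incident E z - {{z, y}}" "Q - {f}"] finQ fin_E by auto
  have "card (E - incident E z) = k - hdegree E z"
    using card_edges fin_E by (subst card_Diff_subset) (auto simp: hdegree_def)
  moreover have "card (C - Q) \<ge> k - hdegree E z"
  proof -
    \<comment> \<open>Since \<open>f'\<close> lies outside \<open>C\<close>, it supplies the one
      hyperedge by which \<open>C\<close> falls short of the \<open>k\<close> edges of the
      tree.\<close>
    have "C \<inter> Q \<subseteq> Q - {f'}" using p by blast
    hence "card (C \<inter> Q) \<le> card (Q - {f'})" using finQ by (intro card_mono) auto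
    also have "\<dots> = hdegree E z - 1" using Q finQ by simp
    finally have "card (C \<inter> Q) \<le> hdegree E z - 1" .
    moreover have "card (C - Q) = card C - card (C \<inter> Q)" using finC by (intro card_Diff_subset_Int) auto
    ultimately show ?thesis using C z2 by simp
  qed
  ultimately obtain \<psi> where \<psi>: "\<psi> ` (E - incident E z) \<subseteq> C - Q" "inj_on \<psi> (E - incident E z)"
    using card_le_inj[of "E - incident E z" "C - Q"] finC fin_E by auto
  have "card (inner V E - {z}) \<le> card A" using card_inner A(2) finI zI by simp
  then obtain \<theta> where \<theta>: "\<theta> ` (inner V E - {z}) \<subseteq> A" "inj_on \<theta> (inner V E - {z})"
    using card_le_inj[of "inner V E - {z}" A] finI A(1) by auto
  define g where "g = \<theta>(z := p)"
  \<comment> \<open>Among the edges at \<open>z\<close>, only \<open>{z, y}\<close> has a second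
    inner end. It takes \<open>f\<close>, which contains \<open>p\<close> together with all of
    \<open>A\<close>; the others only need a hyperedge through \<open>p\<close>.\<close>
  define h where "h e = (if e = {z, y} then f else if z \<in> e then \<phi> e else \<psi> e)" for e
  have hz: "h e \<in> Q \<and> (e \<noteq> {z, y} \<longrightarrow> h e \<noteq> f)" if "e \<in> E" "z \<in> e" for e
    using that \<phi> Q by (auto simp: h_def bij_betw_def)
  have hn: "h e \<in> C - Q" if "e \<in> E" "z \<notin> e" for e
    using that \<psi> by (auto simp: h_def)
  show False
  proof (rule no_skeleton[of g h])
    show "inj_on g (inner V E)"
      using \<theta> p(1) zI unfolding g_def inj_on_def by (auto simp: image_subset_iff)
    show "inj_on h E"
    proof (rule inj_onI)
      fix a b assume ab: "a \<in> E" "b \<in> E" "h a = h b"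
      show "a = b"
      proof (cases "z \<in> a")
        case True
        hence zb: "z \<in> b" using ab hz[of a] hn[of b] by auto
        show ?thesis
        proof (cases "a = {z, y} \<or> b = {z, y}")
          case True
          moreover have "h {z, y} = f" by (simp add: h_def)
          ultimately show ?thesis using hz[OF ab(1) \<open>z \<in> a\<close>] hz[OF ab(2) zb] ab(3) by metis
        next
          case False
          hence "\<phi> a = \<phi> b" using ab(3) True zb by (simp add: h_def)
          thus ?thesis using \<phi> ab False True zb unfolding bij_betw_def inj_on_def by auto
        qed
      next
        case False
        hence zb: "z \<notin> b" using ab hz[of b] hn[of a] by auto
        moreover have "a \<noteq> {z, y}" "b \<noteq> {z, y}" using False zb by auto
        ultimately have "\<psi> a = \<psi> b" using ab(3) False by (simp add: h_def)
        thus ?thesis using \<psi>(2) ab False zb unfolding inj_on_def by auto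
      qed
    qed
    show "h ` E \<subseteq> H" using hz hn Q C by blast
    fix e assume e: "e \<in> E"
    show "g ` (e \<inter> inner V E) \<subseteq> h e"
    proof (cases "e = {z, y}")
      case True
      have "\<theta> y \<in> A" using \<theta> yI edge_neq[OF zy] by auto
      thus ?thesis using True A(3)[OF p(2)] p by (auto simp: g_def h_def)
    next
      case ne: False
      show ?thesis
      proof (cases "z \<in> e")
        case True
        then obtain w where w: "e = {z, w}" using e edgeE[of e z] by blast
        hence "w \<notin> inner V E" using z e ne by (auto simp: end_vertex_def inner_def)
        moreover have "p \<in> h e" using hz[OF e True] Q by blast
        ultimately show ?thesis using w by (auto simp: g_def)
      next
        case False
        hence "h e \<in> C" using hn e by blast
        hence "A \<subseteq> h e" by (rule A(3))
        thus ?thesis using False \<theta> by (auto simp: g_def)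
      qed
    qed
  qed
qed

end

section \<open>Greedy embedding into a family rich in heavy vertices\<close>

context berge_free
begin

text \<open>The tree is grown greedily from the path \<open>l, z, y, x\<close>, where the pendant edge \<open>{z, l}\<close> is left
  without a hyperedge until the very end. At most \<open>k - 2\<close> hyperedges are in use before each
  step, so only that last edge can fail, which happens only if the used hyperedges are
  exactly those at \<open>w\<close>.\<close>

lemma core_step:
  assumes F: "F \<subseteq> H" "\<And>f. f \<in> F \<Longrightarrow> k - 1 \<le> card (f \<inter> W)"
    and W: "\<And>w. w \<in> W \<Longrightarrow> k - 1 \<le> hdegree F w"
    and w: "w \<in> W" "w' \<in> W" "w \<noteq> w'" "f \<in> F" "w \<in> f" "w' \<in> f"
    and g: "g \<in> F" "g \<noteq> f" "w' \<in> g"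
  shows "w \<in> g \<and> incident H w \<subseteq> F \<and> hdegree H w = k - 1"
proof -
  let ?I = "inner V E"
  have finI: "finite ?I" using inner_subset fin_V finite_subset by blast
  have finF: "finite F" using F fin_H finite_subset by blast
  obtain z y where z: "end_vertex z y" using two_end_vertices by metis
  note zy = end_vertexD(1,2)[OF z] and zyI = end_vertexD(3,4)[OF z]
  have other: "\<exists>u. {v, u} \<in> E \<and> u \<noteq> v' \<and> u \<noteq> v"
    if "2 \<le> hdegree E v" for v v'
  proof -
    have "\<not> incident E v \<subseteq> {{v, v'}}"
      using that card_mono[of "{{v, v'}}" "incident E v"] by (auto simp: hdegree_def)
    then obtain e where e: "e \<in> E" "v \<in> e" "e \<noteq> {v, v'}" by blast
    obtain u where "e = {v, u}" "u \<noteq> v" using edgeE[OF e(1,2)] by blast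
    thus ?thesis using e by blast
  qed
  obtain l where l: "{z, l} \<in> E" "l \<noteq> y" "l \<noteq> z"
    using other[OF end_vertexD(5)[OF z]] by blast
  obtain x where x: "{y, x} \<in> E" "x \<noteq> z" "x \<noteq> y"
    using other[OF end_vertexD(6)[OF z]] by blast
  have leaf: "hdegree E l = 1" using z l by (auto simp: end_vertex_def)
  have lI: "l \<notin> ?I" using leaf by (simp add: inner_def)
  have lx: "l \<noteq> x"
    using hdegree_eq_1D[OF leaf l(1), of "{y, x}"] x l zy by (auto simp: doubleton_eq_iff)
  define B where "B = {l, z, y, x}"
  define e0 where "e0 = {z, l}"
  define D where "D S = {e \<in> E. e \<subseteq> S}" for S
  have DB: "D B = {{y, x}, {z, y}, {l, z}}"
  proof (intro equalityI subsetI)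
    fix e assume "e \<in> D B"
    hence e: "e \<in> E" "e \<subseteq> B" by (auto simp: D_def)
    show "e \<in> {{y, x}, {z, y}, {l, z}}"
    proof (cases "l \<in> e")
      case True
      thus ?thesis using hdegree_eq_1D[OF leaf l(1) e(1)] by (auto simp: insert_commute)
    next
      case nl: False
      show ?thesis
      proof (cases "z \<in> e")
        case True
        then obtain t where t: "e = {z, t}" "t \<noteq> z" using edgeE[OF e(1)] by blast
        hence "t = x \<or> t = y" using e(2) nl by (auto simp: B_def)
        moreover have "t \<noteq> x"
        proof
          assume "t = x"
          hence "hdegree E x = 1" using z t e x by (auto simp: end_vertex_def)
          from hdegree_eq_1D[OF this e(1) x(1)] show False
            using t \<open>t = x\<close> zy x by (auto simp: doubleton_eq_iff)
        qed
        ultimately show ?thesis using t by simp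
      next
        case False
        hence "e \<subseteq> {y, x}" using e nl by (auto simp: B_def)
        hence "e = {y, x}" using edge_card[OF e(1)] x by (intro card_subset_eq) auto
        thus ?thesis by simp
      qed
    qed
  qed (use x l zy in \<open>auto simp: D_def B_def insert_commute\<close>)
  \<comment> \<open>Keeping inner images in \<open>W\<close> guarantees each of them at least
    \<open>k - 1\<close> hyperedges of \<open>F\<close> for later edges. Fixing \<open>z\<close> at
    \<open>w\<close> and putting \<open>g\<close> into use from the start is what lets the final
    failure reveal the hyperedges at \<open>w\<close>.\<close>
  define P where "P S \<longleftrightarrow> (\<exists>p h. inj_on p (S \<inter> ?I) \<and> p ` (S \<inter> ?I) \<subseteq> W \<and>
     inj_on h (D S - {e0}) \<and> h ` (D S - {e0}) \<subseteq> F \<and>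
     (\<forall>e\<in>D S - {e0}. p ` (e \<inter> ?I) \<subseteq> h e) \<and> p z = w \<and> g \<in> h ` (D S - {e0}))" for S
  have "P V"
  proof (rule tree_grow_induct[OF tree, of B P])
    show "B \<subseteq> V" using l x edge_subset by (auto simp: B_def)
    have "connected_graph {l} ({} :: 'v set set)" by (auto simp: connected_graph_def)
    hence "connected_graph {z, l} {{l, z}}" by (rule connected_graph_insert) simp
    hence "connected_graph {y, z, l} {{z, y}, {l, z}}" by (rule connected_graph_insert) simp
    hence "connected_graph {x, y, z, l} {{y, x}, {z, y}, {l, z}}"
      by (rule connected_graph_insert) simp
    thus "connected_graph B {e \<in> E. e \<subseteq> B}"
      using DB by (simp add: D_def B_def insert_commute)
    show "P B"
    proof -
      have DB': "D B - {e0} = {{z, y}, {y, x}}"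
        unfolding DB e0_def using l lx zy x by (auto simp: doubleton_eq_iff)
      have BI: "B \<inter> ?I = {z, y} \<union> ({x} \<inter> ?I)" using zyI lI by (auto simp: B_def)
      \<comment> \<open>If \<open>x\<close> is inner, then \<open>z\<close>, \<open>y\<close>,
        \<open>x\<close> are three inner vertices, so \<open>k - 1\<close> is at least 3 and
        \<open>g \<inter> W\<close> has a vertex besides \<open>w\<close> and
        \<open>w'\<close>.\<close>
      have "\<exists>b. x \<in> ?I \<longrightarrow> b \<in> g \<inter> W \<and> b \<noteq> w \<and> b \<noteq> w'"
      proof (cases "x \<in> ?I")
        case True
        hence "card {z, y, x} \<le> card ?I" using zyI finI by (intro card_mono) auto
        hence "3 \<le> k - 1" using card_inner zy x by simp
        hence "3 \<le> card (g \<inter> W)" using F(2)[OF g(1)] by simp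
        hence "\<not> g \<inter> W \<subseteq> {w, w'}" using card_mono[of "{w, w'}" "g \<inter> W"] w(3) by auto
        thus ?thesis by blast
      qed simp
      then obtain b where b: "x \<in> ?I \<Longrightarrow> b \<in> g \<inter> W \<and> b \<noteq> w \<and> b \<noteq> w'" by blast
      let ?p = "(\<lambda>_. b)(z := w, y := w')" and ?h = "(\<lambda>_. g)({z, y} := f)"
      have ne: "{z, y} \<noteq> {y, x}" "{y, x} \<noteq> {z, y}" using x by (auto simp: doubleton_eq_iff)
      show ?thesis
        unfolding P_def BI DB'
      proof (intro exI[of _ ?p] exI[of _ ?h] conjI)
        show "inj_on ?p ({z, y} \<union> ({x} \<inter> ?I))"
          using b w zy x unfolding inj_on_def by auto
        show "?p ` ({z, y} \<union> ({x} \<inter> ?I)) \<subseteq> W" using b w zy x by auto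
        show "inj_on ?h {{z, y}, {y, x}}" using g ne by (auto simp: inj_on_def)
        show "?h ` {{z, y}, {y, x}} \<subseteq> F" using g w ne by auto
        show "g \<in> ?h ` {{z, y}, {y, x}}" using ne by auto
        show "?p z = w" using zy by simp
        show "\<forall>e\<in>{{z, y}, {y, x}}. ?p ` (e \<inter> ?I) \<subseteq> ?h e"
          using b w zy x g ne by auto
      qed
    qed
    fix S a b
    assume S: "B \<subseteq> S" "S \<subseteq> V" "connected_graph S {e \<in> E. e \<subseteq> S}" "P S"
      and ab: "a \<in> S" "b \<in> V" "b \<notin> S" "{a, b} \<in> E"
      and DS: "{e \<in> E. e \<subseteq> insert b S} = insert {a, b} {e \<in> E. e \<subseteq> S}"
    from S(4) obtain p h where p: "inj_on p (S \<inter> ?I)" "p ` (S \<inter> ?I) \<subseteq> W" "p z = w"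
      and h: "inj_on h (D S - {e0})" "h ` (D S - {e0}) \<subseteq> F"
      and ph: "\<And>e. e \<in> D S - {e0} \<Longrightarrow> p ` (e \<inter> ?I) \<subseteq> h e" and gh: "g \<in> h ` (D S - {e0})"
      unfolding P_def by metis
    have zS: "z \<in> S" "l \<in> S" using S by (auto simp: B_def)
    have e0S: "e0 \<in> D S" using zS l by (auto simp: D_def e0_def)
    have abS: "{a, b} \<notin> D S" using ab by (auto simp: D_def)
    have D': "D (insert b S) - {e0} = insert {a, b} (D S - {e0})"
      using DS e0S abS by (auto simp: D_def)
    \<comment> \<open>The attaching vertex has a neighbour inside \<open>S\<close> and the new
      neighbour \<open>b\<close>, so it is inner and already has an image in
      \<open>W\<close>.\<close>
    have aI: "a \<in> ?I"
    proof -
      obtain c where c: "c \<in> S" "c \<noteq> a" using zS l by blast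
      hence "(a, c) \<in> {(x, y). {x, y} \<in> {e \<in> E. e \<subseteq> S}}\<^sup>*"
        using S(3) ab(1) by (auto simp: connected_graph_def)
      then obtain a2 where "{a, a2} \<in> E" "a2 \<in> S" using c(2) by (auto elim: converse_rtranclE)
      hence "2 \<le> hdegree E a"
        using ab by (intro hdegree_ge_2I[of "{a, b}" "{a, a2}"]) (auto simp: doubleton_eq_iff)
      thus ?thesis using ab S by (auto simp: inner_def)
    qed
    have finD: "finite (D S)" using fin_E by (simp add: D_def)
    have "card (D S) \<le> card (E - {{a, b}})"
      using fin_E abS by (intro card_mono) (auto simp: D_def)
    hence "card (D S) \<le> k - 1" using ab fin_E card_edges by simp
    hence "card (D S - {e0}) \<le> k - 2" using e0S finD by simp
    hence "card (h ` (D S - {e0})) \<le> k - 2"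
      using card_image_le[of "D S - {e0}" h] finD by (meson finite_Diff le_trans)
    moreover have "k - 1 \<le> card (incident F (p a))"
      using W[of "p a"] p(2) aI ab by (auto simp: hdegree_def)
    ultimately have "\<not> incident F (p a) \<subseteq> h ` (D S - {e0})"
      using card_mono[of "h ` (D S - {e0})" "incident F (p a)"] finD k_ge_3 by auto
    then obtain f' where f': "f' \<in> F" "p a \<in> f'" "f' \<notin> h ` (D S - {e0})" by blast
    have "\<exists>b'. b \<in> ?I \<longrightarrow> b' \<in> f' \<inter> W \<and> b' \<notin> p ` (S \<inter> ?I)"
    proof (cases "b \<in> ?I")
      case True
      have "card (S \<inter> ?I) \<le> card (?I - {b})" using finI ab by (intro card_mono) auto
      hence "card (S \<inter> ?I) \<le> k - 2" using True finI card_inner by simp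
      hence "card (p ` (S \<inter> ?I)) \<le> k - 2"
        using card_image_le[of "S \<inter> ?I" p] finI by (meson finite_Int le_trans)
      hence "\<not> f' \<inter> W \<subseteq> p ` (S \<inter> ?I)"
        using card_mono[of "p ` (S \<inter> ?I)" "f' \<inter> W"] finI F(2)[OF f'(1)] k_ge_3 by auto
      thus ?thesis by blast
    qed simp
    then obtain b' where b': "b \<in> ?I \<Longrightarrow> b' \<in> f' \<inter> W \<and> b' \<notin> p ` (S \<inter> ?I)" by blast
    let ?p = "p(b := b')" and ?h = "h({a, b} := f')"
    have hD: "?h e = h e" if "e \<in> D S" for e using that abS by auto
    have pS: "?p v = p v" if "v \<in> S" for v using that ab by auto
    show "P (insert b S)"
      unfolding P_def D'
    proof (intro exI[of _ ?p] exI[of _ ?h] conjI)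
      have bI: "insert b S \<inter> ?I = (S \<inter> ?I) \<union> ({b} \<inter> ?I)" by blast
      show "inj_on ?p (insert b S \<inter> ?I)"
        unfolding bI using p(1) b' ab(3) unfolding inj_on_def by auto
      show "?p ` (insert b S \<inter> ?I) \<subseteq> W"
        unfolding bI using p(2) b' ab(3) by auto
      show "inj_on ?h (insert {a, b} (D S - {e0}))"
        using h(1) f'(3) abS unfolding inj_on_def by auto
      show "?h ` insert {a, b} (D S - {e0}) \<subseteq> F"
        using h(2) f'(1) by auto
      show "?p z = w" using p(3) zS ab by auto
      show "g \<in> ?h ` insert {a, b} (D S - {e0})"
        using gh hD by (smt (verit) DiffD1 image_iff insert_iff)
      show "\<forall>e\<in>insert {a, b} (D S - {e0}). ?p ` (e \<inter> ?I) \<subseteq> ?h e"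
      proof
        fix e assume "e \<in> insert {a, b} (D S - {e0})"
        then consider "e = {a, b}" | "e \<in> D S - {e0}" by blast
        thus "?p ` (e \<inter> ?I) \<subseteq> ?h e"
        proof cases
          case 1
          thus ?thesis using f'(2) b' pS[OF ab(1)] by auto
        next
          case 2
          hence "e \<subseteq> S" by (simp add: D_def)
          hence "?p ` (e \<inter> ?I) = p ` (e \<inter> ?I)"
            using pS by (intro image_cong refl) blast
          moreover have "?h e = h e" using hD 2 by blast
          ultimately show ?thesis using ph[OF 2] by simp
        qed
      qed
    qed
  qed
  moreover have DV: "D V = E" using edge_subset by (auto simp: D_def)
  moreover have VI: "V \<inter> ?I = ?I" using inner_subset by blast
  ultimately obtain p h where p: "inj_on p ?I" "p z = w"
    and h: "inj_on h (E - {e0})" "h ` (E - {e0}) \<subseteq> F"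
    and ph: "\<And>e. e \<in> E - {e0} \<Longrightarrow> p ` (e \<inter> ?I) \<subseteq> h e" and gh: "g \<in> h ` (E - {e0})"
    unfolding P_def by metis
  let ?Q = "h ` (E - {e0})"
  have e0E: "e0 \<in> E" using l by (simp add: e0_def)
  have cQ: "card ?Q = k - 1" using card_image[OF h(1)] e0E fin_E card_edges by simp
  have sub: "incident H w \<subseteq> ?Q"
  proof (rule ccontr)
    assume "\<not> ?thesis"
    then obtain h0 where h0: "h0 \<in> H" "w \<in> h0" "h0 \<notin> ?Q" by blast
    show False
    proof (rule no_skeleton[OF p(1), of "h(e0 := h0)"])
      show "inj_on (h(e0 := h0)) E"
        using h(1) h0(3) unfolding inj_on_def by auto
      show "(h(e0 := h0)) ` E \<subseteq> H" using h(2) h0 F(1) by auto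
      show "p ` (e \<inter> ?I) \<subseteq> (h(e0 := h0)) e" if "e \<in> E" for e
        using ph[of e] that h0 p(2) lI by (auto simp: e0_def)
    qed
  qed
  have "k - 1 \<le> card (incident H w)"
  proof -
    have "card (incident F w) \<le> card (incident H w)" using F(1) fin_H by (intro card_mono) auto
    thus ?thesis using W[OF w(1)] by (simp add: hdegree_def)
  qed
  hence "incident H w = ?Q" using sub cQ fin_E by (intro card_seteq) auto
  thus ?thesis using gh h(2) cQ by (auto simp: hdegree_def)
qed

end

section \<open>Weights of hyperedges\<close>

text \<open>Hyperedges are removed one by one, each losing \<open>r - q\<close> incidences at vertices whose
  current degree is at most \<open>q\<close>. Strictness comes from the last hyperedge.\<close>

lemma peeling_bound:
  fixes q r :: nat
  assumes "finite X" "0 < q" "0 < r"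
    and "finite H" "H \<noteq> {}" "\<And>f. f \<in> H \<Longrightarrow> f \<subseteq> X \<and> card f = r"
    and "\<And>F. F \<subseteq> H \<Longrightarrow> F \<noteq> {} \<Longrightarrow> \<exists>f\<in>F. card (f \<inter> {v. q < hdegree F v}) \<le> q"
  shows "(r - q) * card H < (\<Sum>v\<in>X. min (hdegree H v) q)"
  using assms(4-)
proof (induction "card H" arbitrary: H rule: less_induct)
  case less
  obtain f where f: "f \<in> H" "card (f \<inter> {v. q < hdegree H v}) \<le> q"
    using less.prems(4)[of H] less.prems(2) by blast
  have fX: "f \<subseteq> X" and cf: "card f = r" using less.prems(3)[OF f(1)] by auto
  have finf: "finite f" using fX assms(1) finite_subset by blast
  define low where "low = f \<inter> {v. hdegree H v \<le> q}"
  let ?H = "H - {f}"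
  have deg: "hdegree H v = hdegree ?H v + (if v \<in> f then 1 else 0)" for v
  proof (cases "v \<in> f")
    case True
    hence "incident H v = insert f (incident ?H v)" using f(1) by auto
    moreover have "finite (incident ?H v)" using less.prems(1) by simp
    ultimately show ?thesis using True by (simp add: hdegree_def)
  next
    case False
    hence "incident H v = incident ?H v" by auto
    thus ?thesis using False by (simp add: hdegree_def)
  qed
  \<comment> \<open>Deleting \<open>f\<close> lowers the truncated degree by one exactly at the
    vertices of \<open>low\<close>; above \<open>q\<close> the truncation hides the loss.\<close>
  have "(\<Sum>v\<in>X. min (hdegree ?H v) q) + card low
      = (\<Sum>v\<in>X. min (hdegree ?H v) q + (if v \<in> low then 1 else 0))"
  proof -
    have "X \<inter> low = low" using fX by (auto simp: low_def)
    thus ?thesis using assms(1) by (simp add: sum.distrib sum.If_cases)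
  qed
  also have "\<dots> \<le> (\<Sum>v\<in>X. min (hdegree H v) q)"
    by (intro sum_mono) (use deg in \<open>auto simp: low_def\<close>)
  finally have step: "(\<Sum>v\<in>X. min (hdegree ?H v) q) + card low
      \<le> (\<Sum>v\<in>X. min (hdegree H v) q)" .
  have "card f = card low + card (f \<inter> {v. q < hdegree H v})"
    unfolding low_def using finf by (subst card_Un_disjoint[symmetric]) (auto intro: arg_cong[of _ _ card])
  hence clow: "r - q \<le> card low" using f(2) cf by simp
  have cH: "card H = Suc (card ?H)" by (rule card.remove[OF less.prems(1) f(1)])
  show ?case
  proof (cases "?H = {}")
    case True
    have "hdegree ?H v = 0" for v unfolding True by (simp add: hdegree_def)
    \<comment> \<open>With a single hyperedge left, all degrees are at most 1, so it loses all
      \<open>r\<close> incidences instead of \<open>r - q\<close>.\<close>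
    hence "hdegree H v \<le> q" for v using deg[of v] assms(2) by simp
    hence "low = f" by (auto simp: low_def)
    thus ?thesis using step cf cH True assms(2,3) by simp
  next
    case False
    have "(r - q) * card ?H < (\<Sum>v\<in>X. min (hdegree ?H v) q)"
    proof (rule less.hyps)
      show "\<exists>f\<in>F. card (f \<inter> {v. q < hdegree F v}) \<le> q" if "F \<subseteq> ?H" "F \<noteq> {}" for F
        using less.prems(4)[of F] that by blast
    qed (use less.prems cH False in auto)
    thus ?thesis using step clow cH by simp
  qed
qed

definition hweight :: "'a set set \<Rightarrow> 'a set \<Rightarrow> real" where
  "hweight H f = (\<Sum>v\<in>f. 1 / real (hdegree H v))"

text \<open>Double counting of incidences. A vertex whose hyperedges all belong to \<open>C\<close>
  contributes 1 if it is covered at all; for other vertices the fraction measures how much of their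
  weight \<open>C\<close> receives.\<close>

lemma sum_hweight:
  assumes "finite X" "finite C" "\<And>f. f \<in> C \<Longrightarrow> f \<subseteq> X"
  shows "(\<Sum>f\<in>C. hweight H f) = (\<Sum>v\<in>X. real (hdegree C v) / real (hdegree H v))"
proof -
  have "(\<Sum>f\<in>C. hweight H f) = (\<Sum>f\<in>C. \<Sum>v | v \<in> X \<and> v \<in> f. 1 / real (hdegree H v))"
    unfolding hweight_def by (intro sum.cong refl) (use assms(3) in auto)
  also have "\<dots> = (\<Sum>v\<in>X. \<Sum>f | f \<in> C \<and> v \<in> f. 1 / real (hdegree H v))"
    by (rule sum.swap_restrict[OF assms(2,1)])
  finally show ?thesis by (simp add: hdegree_def)
qed

lemma sum_mono_equal:
  fixes f g :: "'a \<Rightarrow> real"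
  assumes "finite A" "\<And>x. x \<in> A \<Longrightarrow> f x \<le> g x" "sum g A \<le> sum f A" "x \<in> A"
  shows "f x = g x"
  using sum_mono_inv[of f A g x] assms sum_mono[of A f g] by fastforce

text \<open>Isolates what the weight estimate needs of a class: \<open>m\<close> stands for
  \<open>k - 1\<close> and \<open>s\<close> for the degree of \<open>z\<close> minus 1. The tree
  survives only in \<open>outgoing\<close> and in \<open>2 * s \<le> m\<close>.\<close>

locale hyperedge_class =
  fixes H C :: "'a set set" and m r s :: nat
  assumes fin_H: "finite H" and C_sub: "C \<subseteq> H" and card_C: "card C = m" and m_ge: "2 \<le> m"
    and edge_fin: "f \<in> C \<Longrightarrow> finite f" and edge_size: "f \<in> C \<Longrightarrow> card f = r"
    and r_pos: "0 < r" and s_le: "2 * s \<le> m"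
    and outgoing: "f \<in> C \<Longrightarrow> v \<in> f \<Longrightarrow> \<not> incident H v \<subseteq> C \<Longrightarrow> hdegree H v \<le> s"
begin

lemma fin_C: "finite C"
  using C_sub fin_H finite_subset by blast

lemma fin_Union: "finite (\<Union>C)"
  using fin_C edge_fin by blast

lemma hdegree_pos:
  assumes "v \<in> \<Union>C" shows "0 < hdegree C v" "0 < hdegree H v"
proof -
  have ne: "incident C v \<noteq> {}" "incident H v \<noteq> {}" using assms C_sub by auto
  moreover have "finite (incident C v)" "finite (incident H v)" using fin_C fin_H by auto
  ultimately show "0 < hdegree C v" "0 < hdegree H v"
    unfolding hdegree_def using card_gt_0_iff by blast+
qed

lemma closed_hdegree:
  assumes "incident H v \<subseteq> C" shows "hdegree C v = hdegree H v"
proof -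
  have "incident C v = incident H v" using assms C_sub by blast
  thus ?thesis by (simp add: hdegree_def)
qed

lemma hdegree_le:
  assumes "v \<in> \<Union>C" shows "hdegree H v \<le> m"
proof (cases "incident H v \<subseteq> C")
  case True
  hence "card (incident H v) \<le> card C" using fin_C by (intro card_mono)
  thus ?thesis using card_C by (simp add: hdegree_def)
next
  case False
  thus ?thesis using outgoing assms s_le by fastforce
qed

text \<open>Every covered vertex passes its full weight 1 to the class, and two distinct sets of
  size \<open>r\<close> cover at least \<open>r + 1\<close> vertices.\<close>

lemma weight_closed:
  assumes "\<And>v. v \<in> \<Union>C \<Longrightarrow> incident H v \<subseteq> C"
  shows "(\<Sum>f\<in>C. hweight H f) = card (\<Union>C)" "r + 1 \<le> card (\<Union>C)"
proof -
  have "(\<Sum>f\<in>C. hweight H f) = (\<Sum>v\<in>\<Union>C. real (hdegree C v) / real (hdegree H v))"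
    by (rule sum_hweight) (use fin_Union fin_C in auto)
  also have "\<dots> = (\<Sum>v\<in>\<Union>C. 1)"
  proof (rule sum.cong[OF refl])
    fix v assume "v \<in> \<Union>C"
    thus "real (hdegree C v) / real (hdegree H v) = 1"
      using closed_hdegree[OF assms] hdegree_pos(2) by simp
  qed
  finally show "(\<Sum>f\<in>C. hweight H f) = card (\<Union>C)" by simp
  obtain f g where fg: "f \<in> C" "g \<in> C" "f \<noteq> g"
    using card_C m_ge by (metis card_le_Suc0_iff_eq fin_C not_less_eq_eq numeral_2_eq_2)
  have "f \<subset> \<Union>C"
  proof
    show "f \<noteq> \<Union>C"
    proof
      assume "f = \<Union>C"
      hence "g \<subseteq> f" using fg by blast
      hence "g = f" using edge_size fg edge_fin by (intro card_subset_eq) auto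
      thus False using fg by simp
    qed
  qed (use fg in blast)
  hence "card f < card (\<Union>C)" by (intro psubset_card_mono fin_Union)
  thus "r + 1 \<le> card (\<Union>C)" using edge_size fg by simp
qed

text \<open>The vertices of \<open>f0\<close> contribute exactly \<open>r\<close>, so the rest
  \<open>R\<close> must exceed 1. A closed vertex of \<open>R\<close> gives 1 and \<open>u\<close>
  adds something positive. If there is none, each of the \<open>m - 1\<close> other hyperedges meets
  \<open>R\<close> in a vertex of degree at most \<open>s\<close>, giving at least
  \<open>(m - 1) / s\<close>.\<close>

lemma weight_partly_closed:
  assumes f0: "f0 \<in> C" "\<And>v. v \<in> f0 \<Longrightarrow> incident H v \<subseteq> C"
    and u: "u \<in> \<Union>C" "\<not> incident H u \<subseteq> C"
  shows "real (r + 1) < (\<Sum>f\<in>C. hweight H f)"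
proof -
  let ?t = "\<lambda>v. real (hdegree C v) / real (hdegree H v)"
  define R where "R = \<Union>C - f0"
  have finR: "finite R" using fin_Union by (simp add: R_def)
  have uR: "u \<in> R" using u f0 by (auto simp: R_def)
  have pos: "0 < ?t v" if "v \<in> \<Union>C" for v using hdegree_pos[OF that] by simp
  have one: "?t v = 1" if "v \<in> \<Union>C" "incident H v \<subseteq> C" for v
    using closed_hdegree[OF that(2)] hdegree_pos(2)[OF that(1)] by simp
  have "(\<Sum>f\<in>C. hweight H f) = (\<Sum>v\<in>\<Union>C. ?t v)"
    by (rule sum_hweight) (use fin_Union fin_C in auto)
  also have "\<dots> = (\<Sum>v\<in>R. ?t v) + (\<Sum>v\<in>f0. ?t v)"
    unfolding R_def by (rule sum.subset_diff) (use f0 fin_Union in auto)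
  also have "(\<Sum>v\<in>f0. ?t v) = (\<Sum>v\<in>f0. 1)"
    by (intro sum.cong refl one) (use f0 in auto)
  finally have total: "(\<Sum>f\<in>C. hweight H f) = (\<Sum>v\<in>R. ?t v) + real r"
    using edge_size[OF f0(1)] by simp
  have "1 < (\<Sum>v\<in>R. ?t v)"
  proof (cases "\<exists>v\<in>R. incident H v \<subseteq> C")
    case True
    then obtain v where v: "v \<in> R" "incident H v \<subseteq> C" by blast
    hence "v \<noteq> u" using u by blast
    hence "?t v + ?t u = (\<Sum>v\<in>{v, u}. ?t v)" by simp
    also have "\<dots> \<le> (\<Sum>v\<in>R. ?t v)" using v uR finR by (intro sum_mono2) auto
    finally show ?thesis using one[of v] v pos[of u] u by (auto simp: R_def)
  next
    case False
    have du: "hdegree H u \<le> s" using outgoing u by blast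
    obtain f f' where f: "f \<in> C" "u \<in> f" and f': "f' \<in> H" "u \<in> f'" "f' \<notin> C" using u by blast
    have "card {f, f'} \<le> card (incident H u)"
      using f f' C_sub fin_H by (intro card_mono) auto
    \<comment> \<open>With hyperedges on both sides, \<open>u\<close> has degree at least 2. This
      matters for strictness: for \<open>s = 1\<close> and \<open>m = 2\<close> the quotient
      \<open>(m - 1) / s\<close> would be just 1.\<close>
    hence s2: "2 \<le> s" using du f f' by (auto simp: hdegree_def card_insert_if split: if_splits)
    have "real (m - 1) = (\<Sum>f\<in>C - {f0}. 1)" using fin_C f0 card_C by simp
    also have "\<dots> \<le> (\<Sum>f\<in>C - {f0}. real (card (f \<inter> R)))"
    proof (rule sum_mono)
      fix f assume f: "f \<in> C - {f0}"
      have "\<not> f \<subseteq> f0"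
        using card_subset_eq[of f0 f] edge_fin[OF f0(1)] edge_size[OF f0(1)] edge_size[of f] f by auto
      hence "f \<inter> R \<noteq> {}" using f by (auto simp: R_def)
      moreover have "finite (f \<inter> R)" using finR by simp
      ultimately have "0 < card (f \<inter> R)" by (simp add: card_gt_0_iff)
      thus "1 \<le> real (card (f \<inter> R))" by simp
    qed
    also have "\<dots> \<le> (\<Sum>f\<in>C. real (card (f \<inter> R)))" using fin_C by (intro sum_mono2) auto
    also have "\<dots> = (\<Sum>v\<in>R. real (hdegree C v))"
    proof -
      have "(\<Sum>f\<in>C. real (card (f \<inter> R))) = (\<Sum>f\<in>C. \<Sum>v | v \<in> R \<and> v \<in> f. 1)"
        by (intro sum.cong refl) (auto simp: Int_def conj_commute)
      also have "\<dots> = (\<Sum>v\<in>R. \<Sum>f | f \<in> C \<and> v \<in> f. 1)" by (rule sum.swap_restrict[OF fin_C finR])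
      finally show ?thesis by (simp add: hdegree_def)
    qed
    finally have "real (m - 1) / real s \<le> (\<Sum>v\<in>R. real (hdegree C v)) / real s"
      by (intro divide_right_mono) auto
    also have "\<dots> = (\<Sum>v\<in>R. real (hdegree C v) / real s)" by (rule sum_divide_distrib)
    also have "\<dots> \<le> (\<Sum>v\<in>R. ?t v)"
    proof (rule sum_mono)
      fix v assume v: "v \<in> R"
      moreover have "\<not> incident H v \<subseteq> C" using False v by blast
      ultimately have "hdegree H v \<le> s" using outgoing unfolding R_def by blast
      thus "real (hdegree C v) / real s \<le> ?t v"
        using hdegree_pos[of v] v by (intro divide_left_mono) (auto simp: R_def)
    qed
    finally have "real (m - 1) / real s \<le> (\<Sum>v\<in>R. ?t v)" .
    moreover have "1 < real (m - 1) / real s" using s2 s_le by simp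
    ultimately show ?thesis by linarith
  qed
  thus ?thesis using total by simp
qed

text \<open>The outgoing vertex has degree at most \<open>m / 2\<close> and contributes at least
  \<open>2 / m\<close>, each of the other \<open>r - 1\<close> vertices at least
  \<open>1 / m\<close>. In the tight case those others have degree \<open>m = 2 * s > s\<close>, so
  none is outgoing and each lies in exactly the hyperedges of \<open>C\<close>.\<close>

lemma weight_all_outgoing:
  assumes f: "f \<in> C" and y: "y \<in> f" "\<not> incident H y \<subseteq> C"
  shows "real (r + 1) / real m \<le> hweight H f"
    and "hweight H f = real (r + 1) / real m \<Longrightarrow>
      2 * s = m \<and> hdegree H y = s \<and> f = insert y {v. incident H v = C}"
proof -
  have d_pos: "0 < hdegree H v" if "v \<in> f" for v using that f hdegree_pos(2) by blast
  have d_le: "hdegree H v \<le> m" if "v \<in> f" for v using that f hdegree_le by blast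
  have dy: "2 * hdegree H y \<le> m" using outgoing[OF f y] s_le by simp
  have eq: "hweight H f = 1 / real (hdegree H y) + (\<Sum>v\<in>f - {y}. 1 / real (hdegree H v))"
    unfolding hweight_def by (rule sum.remove[OF edge_fin[OF f] y(1)])
  have ly: "2 / real m \<le> 1 / real (hdegree H y)"
    using dy d_pos[OF y(1)] m_ge by (simp add: field_simps flip: of_nat_mult)
  have lv: "1 / real m \<le> 1 / real (hdegree H v)" if "v \<in> f - {y}" for v
    using d_pos[of v] d_le[of v] that by (intro divide_left_mono) auto
  have c: "(\<Sum>v\<in>f - {y}. 1 / real m) = (real r - 1) / real m"
    using edge_size[OF f] edge_fin[OF f] y r_pos by (simp add: of_nat_diff)
  have lsum: "(\<Sum>v\<in>f - {y}. 1 / real m) \<le> (\<Sum>v\<in>f - {y}. 1 / real (hdegree H v))"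
    by (intro sum_mono lv)
  have split: "real (r + 1) / real m = 2 / real m + (real r - 1) / real m"
    by (simp add: add_divide_distrib diff_divide_distrib)
  show "real (r + 1) / real m \<le> hweight H f" using eq ly lsum c split by linarith
  assume tight: "hweight H f = real (r + 1) / real m"
  have "1 / real (hdegree H y) = 2 / real m" using eq ly lsum c split tight by linarith
  hence "2 * real (hdegree H y) = real m" using d_pos[OF y(1)] m_ge by (simp add: field_simps)
  hence "2 * hdegree H y = m" by linarith
  hence sy: "2 * s = m" "hdegree H y = s" using outgoing[OF f y] s_le by auto
  have ls: "(\<Sum>v\<in>f - {y}. 1 / real (hdegree H v)) \<le> (\<Sum>v\<in>f - {y}. 1 / real m)"
    using eq ly lsum c split tight by linarith
  have "incident H v = C" if v: "v \<in> f - {y}" for v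
  proof -
    have "1 / real m = 1 / real (hdegree H v)"
      by (rule sum_mono_equal[OF _ _ ls v]) (use lv edge_fin[OF f] in auto)
    hence dv: "hdegree H v = m" using d_pos[of v] v m_ge by (simp add: field_simps)
    have "incident H v \<subseteq> C"
    proof (rule ccontr)
      assume "\<not> ?thesis"
      hence "hdegree H v \<le> s" using outgoing[OF f] v by blast
      thus False using dv sy m_ge by simp
    qed
    thus ?thesis using dv card_C fin_C by (intro card_subset_eq) (auto simp: hdegree_def)
  qed
  moreover have "{v. incident H v = C} \<subseteq> f" using f by blast
  ultimately have "f = insert y {v. incident H v = C}" using y by blast
  thus "2 * s = m \<and> hdegree H y = s \<and> f = insert y {v. incident H v = C}" using sy by blast
qed

definition closed_block :: bool where
  "closed_block \<longleftrightarrow> card (\<Union>C) = r + 1 \<and> (\<forall>v\<in>\<Union>C. incident H v \<subseteq> C)"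

text \<open>The kernel is the set of vertices whose hyperedges are exactly those of
  \<open>C\<close>, and every petal is a single vertex \<open>y\<close> of degree
  \<open>s\<close>.\<close>

definition sunflower :: bool where
  "sunflower \<longleftrightarrow> 2 * s = m \<and>
     (\<forall>f\<in>C. \<exists>y. hdegree H y = s \<and> f = insert y {v. incident H v = C})"

lemma class_weight:
  shows "real (r + 1) \<le> (\<Sum>f\<in>C. hweight H f)"
    and "(\<Sum>f\<in>C. hweight H f) = real (r + 1) \<Longrightarrow> closed_block \<or> sunflower"
proof -
  consider (closed) "\<forall>v\<in>\<Union>C. incident H v \<subseteq> C"
    | (partly) "\<exists>f0\<in>C. \<forall>v\<in>f0. incident H v \<subseteq> C" "\<exists>u\<in>\<Union>C. \<not> incident H u \<subseteq> C"
    | (out) "\<forall>f\<in>C. \<exists>y\<in>f. \<not> incident H y \<subseteq> C"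
    by blast
  hence "real (r + 1) \<le> (\<Sum>f\<in>C. hweight H f) \<and>
    ((\<Sum>f\<in>C. hweight H f) = real (r + 1) \<longrightarrow> closed_block \<or> sunflower)"
  proof cases
    case closed
    show ?thesis
      using weight_closed[OF bspec[OF closed]] closed unfolding closed_block_def by auto
  next
    case partly
    then obtain f0 u where "f0 \<in> C" "\<forall>v\<in>f0. incident H v \<subseteq> C"
      "u \<in> \<Union>C" "\<not> incident H u \<subseteq> C" by blast
    thus ?thesis using weight_partly_closed[of f0 u] by simp
  next
    case out
    have c: "(\<Sum>f\<in>C. real (r + 1) / real m) = real (r + 1)" using card_C m_ge by simp
    have le: "real (r + 1) / real m \<le> hweight H f" if "f \<in> C" for f
      using out weight_all_outgoing(1)[OF that] that by blast
    have "real (r + 1) \<le> (\<Sum>f\<in>C. hweight H f)" using sum_mono[of C, OF le] c by simp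
    moreover have sunflower if eq: "(\<Sum>f\<in>C. hweight H f) = real (r + 1)"
    proof -
      have tight: "hweight H f = real (r + 1) / real m" if "f \<in> C" for f
        using sum_mono_equal[of C "\<lambda>_. real (r + 1) / real m" "hweight H", OF fin_C le _ that]
          eq c by simp
      have "\<exists>y. 2 * s = m \<and> hdegree H y = s \<and> f = insert y {v. incident H v = C}"
        if f: "f \<in> C" for f
        using out weight_all_outgoing(2)[OF f _ _ tight[OF f]] f by blast
      moreover have "C \<noteq> {}" using card_C m_ge by auto
      ultimately show ?thesis unfolding sunflower_def by blast
    qed
    ultimately show ?thesis by blast
  qed
  thus "real (r + 1) \<le> (\<Sum>f\<in>C. hweight H f)"
    and "(\<Sum>f\<in>C. hweight H f) = real (r + 1) \<Longrightarrow> closed_block \<or> sunflower" by blast+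
qed

end

section \<open>The core of a Berge-free hypergraph\<close>

lemma hdegree_mono: "finite G \<Longrightarrow> F \<subseteq> G \<Longrightarrow> hdegree F v \<le> hdegree G v"
  unfolding hdegree_def by (intro card_mono) auto

context berge_free
begin

definition core :: "'a set set \<Rightarrow> bool" where
  "core F \<longleftrightarrow> (\<forall>f\<in>F. k - 1 \<le> card (f \<inter> {v. k - 1 \<le> hdegree F v}))"

text \<open>Enlarging a family only raises degrees, so a union of cores is again a core; this union
  is the largest one.\<close>

definition max_core :: "'a set set" where
  "max_core = \<Union>{F. F \<subseteq> H \<and> core F}"

definition heavy :: "'a set" where
  "heavy = {v. k - 1 \<le> hdegree max_core v}"

lemma max_core_subset: "max_core \<subseteq> H"
  by (auto simp: max_core_def)

lemma fin_max_core: "finite max_core"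
  using max_core_subset fin_H finite_subset by blast

lemma max_core_heavy:
  assumes "f \<in> max_core" shows "k - 1 \<le> card (f \<inter> heavy)"
proof -
  obtain F where F: "f \<in> F" "F \<subseteq> H" "core F" using assms by (auto simp: max_core_def)
  hence sub: "F \<subseteq> max_core" by (auto simp: max_core_def)
  have "k - 1 \<le> card (f \<inter> {v. k - 1 \<le> hdegree F v})" using F by (simp add: core_def)
  also have "\<dots> \<le> card (f \<inter> heavy)"
  proof (rule card_mono)
    show "finite (f \<inter> heavy)" using fin_hyperedge F by blast
    show "f \<inter> {v. k - 1 \<le> hdegree F v} \<subseteq> f \<inter> heavy"
      using hdegree_mono[OF fin_max_core sub] le_trans by (fastforce simp: heavy_def)
  qed
  finally show ?thesis .
qed

text \<open>Since \<open>k - 1\<close> is at least 2, a hyperedge of the core at \<open>w\<close>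
  has a second heavy vertex \<open>w'\<close>, and \<open>w'\<close> lies in a further hyperedge;
  this is the input of \<open>core_step\<close>. The third fact, used in both directions, shows that
  heavy vertices sharing a core hyperedge have the same hyperedges.\<close>

lemma heavy_incident:
  assumes w: "w \<in> heavy"
  shows "incident H w \<subseteq> max_core" "hdegree H w = k - 1"
    and "f \<in> max_core \<Longrightarrow> w \<in> f \<Longrightarrow> w' \<in> f \<Longrightarrow> w' \<in> heavy \<Longrightarrow> w' \<noteq> w \<Longrightarrow>
      incident max_core w' \<subseteq> incident H w"
proof -
  let ?F = "max_core"
  have step: "w \<in> g \<and> incident H w \<subseteq> ?F \<and> hdegree H w = k - 1"
    if "w' \<in> heavy" "w' \<noteq> w" "f \<in> ?F" "w \<in> f" "w' \<in> f" "g \<in> ?F" "g \<noteq> f" "w' \<in> g" for w' f g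
    by (rule core_step[OF max_core_subset max_core_heavy _ w that(1) _ that(3-8)])
       (use that(2) in \<open>auto simp: heavy_def\<close>)
  have two: "\<exists>g\<in>?F. v \<in> g \<and> g \<noteq> f" if "v \<in> heavy" for v f
  proof -
    have "\<not> incident ?F v \<subseteq> {f}"
      using that k_ge_3 card_mono[of "{f}" "incident ?F v"] by (auto simp: heavy_def hdegree_def)
    thus ?thesis by blast
  qed
  obtain f where f: "f \<in> ?F" "w \<in> f" using two[OF w, of "{}"] by blast
  have "\<not> f \<inter> heavy \<subseteq> {w}"
    using max_core_heavy[OF f(1)] card_mono[of "{w}" "f \<inter> heavy"] k_ge_3 by auto
  then obtain w' where w': "w' \<in> f" "w' \<in> heavy" "w' \<noteq> w" by blast
  obtain g where g: "g \<in> ?F" "w' \<in> g" "g \<noteq> f" using two[OF w'(2)] by blast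
  show "incident H w \<subseteq> ?F" "hdegree H w = k - 1"
    using step[OF w'(2,3) f w'(1) g(1,3,2)] by blast+
  show "incident max_core w' \<subseteq> incident H w"
    if "f \<in> max_core" "w \<in> f" "w' \<in> f" "w' \<in> heavy" "w' \<noteq> w" for f w'
  proof
    fix g assume g: "g \<in> incident ?F w'"
    show "g \<in> incident H w"
      using step[OF that(4,5,1,2,3), of g] g that(2) max_core_subset by (cases "g = f") auto
  qed
qed

lemma incident_heavy: "w \<in> heavy \<Longrightarrow> incident max_core w = incident H w"
  using heavy_incident(1)[of w] max_core_subset by blast

lemma heavy_share:
  assumes "w \<in> heavy" "w' \<in> heavy" "f \<in> max_core" "w \<in> f" "w' \<in> f"
  shows "incident H w' = incident H w"
proof (cases "w' = w")
  case False
  have "incident H w' \<subseteq> incident H w"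
    using heavy_incident(3)[OF assms(1,3,4,5,2) False] incident_heavy[OF assms(2)] by simp
  moreover have "incident H w \<subseteq> incident H w'"
    using heavy_incident(3)[OF assms(2,3,5,4,1)] False incident_heavy[OF assms(1)] by simp
  ultimately show ?thesis by blast
qed simp

definition classes :: "'a set set set" where
  "classes = incident H ` heavy"

lemma max_core_has_heavy:
  assumes "f \<in> max_core" obtains w where "w \<in> heavy" "w \<in> f"
proof -
  have "0 < card (f \<inter> heavy)" using max_core_heavy[OF assms] k_ge_3 by simp
  hence "f \<inter> heavy \<noteq> {}" by auto
  thus thesis using that by blast
qed

lemma Union_classes: "\<Union>classes = max_core"
proof (intro equalityI subsetI)
  fix f assume "f \<in> \<Union>classes"
  thus "f \<in> max_core" using heavy_incident(1) unfolding classes_def by blast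
next
  fix f assume f: "f \<in> max_core"
  then obtain w where "w \<in> heavy" "w \<in> f" by (rule max_core_has_heavy)
  thus "f \<in> \<Union>classes" using f max_core_subset unfolding classes_def by blast
qed

lemma classes_disjoint:
  assumes "C \<in> classes" "C' \<in> classes" "f \<in> C" "f \<in> C'" shows "C = C'"
proof -
  obtain w w' where w: "w \<in> heavy" "C = incident H w" "w' \<in> heavy" "C' = incident H w'"
    using assms unfolding classes_def by blast
  have "f \<in> max_core" using assms(1,3) Union_classes by blast
  thus ?thesis using heavy_share[of w' w f] w assms by blast
qed

text \<open>A hyperedge of the class has at least \<open>k - 1\<close> heavy vertices, and they all
  have the same incident hyperedges. They form the common set \<open>A\<close> that
  \<open>outgoing_hdegree_less\<close> asks for.\<close>

lemma class_props:
  assumes "C \<in> classes"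
  shows "C \<subseteq> H" "card C = k - 1" "k - 1 \<le> card {v. incident H v = C}"
    "finite {v. incident H v = C}" "f \<in> C \<Longrightarrow> {v. incident H v = C} \<subseteq> f"
proof -
  obtain w where w: "w \<in> heavy" "C = incident H w" using assms unfolding classes_def by blast
  show C: "C \<subseteq> H" "card C = k - 1" using w heavy_incident(2)[OF w(1)] by (auto simp: hdegree_def)
  show sub: "{v. incident H v = C} \<subseteq> f" if "f \<in> C" for f using that by blast
  have "C \<noteq> {}" using C k_ge_3 by auto
  then obtain f where f: "f \<in> C" by blast
  show fin: "finite {v. incident H v = C}"
    using sub[OF f] fin_hyperedge[of f] C f finite_subset by blast
  have fF: "f \<in> max_core" using f assms Union_classes by blast
  have "f \<inter> heavy \<subseteq> {v. incident H v = C}"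
    using heavy_share[OF w(1) _ fF] f w(2) by blast
  hence "card (f \<inter> heavy) \<le> card {v. incident H v = C}" by (intro card_mono fin)
  thus "k - 1 \<le> card {v. incident H v = C}" using max_core_heavy[OF fF] by simp
qed

text \<open>A family in which every hyperedge is rich in heavy vertices is a core and would already
  have been absorbed by \<open>max_core\<close>.\<close>

lemma outside_core_sparse:
  assumes "F \<subseteq> H - max_core" "F \<noteq> {}"
  shows "\<exists>f\<in>F. card (f \<inter> {v. k - 2 < hdegree F v}) \<le> k - 2"
proof (rule ccontr)
  assume neg: "\<not> ?thesis"
  have "core F"
    unfolding core_def
  proof
    fix f assume "f \<in> F"
    hence "k - 2 < card (f \<inter> {v. k - 2 < hdegree F v})" using neg by force
    moreover have "(k - 2 < x) = (k - 1 \<le> x)" for x using k_ge_3 by linarith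
    ultimately show "k - 1 \<le> card (f \<inter> {v. k - 1 \<le> hdegree F v})" by simp
  qed
  hence "F \<subseteq> max_core" using assms(1) unfolding max_core_def by blast
  thus False using assms by blast
qed

end

section \<open>Total weight of the core and of its complement\<close>

locale berge_free_end = berge_free V E k r X H
  for V :: "'v set" and E :: "'v set set" and k r :: nat and X :: "'a set" and H :: "'a set set" +
  fixes z y :: 'v
  assumes end_zy: "end_vertex z y" and deg_z: "2 * hdegree E z \<le> k + 1"
begin

definition s :: nat where "s = hdegree E z - 1"

lemma two_s: "2 * s \<le> k - 1"
  using deg_z by (simp add: s_def)

lemma outgoing_le:
  assumes "C \<in> classes" "f \<in> C" "v \<in> f" "\<not> incident H v \<subseteq> C"
  shows "hdegree H v \<le> s"
proof -
  obtain f' where "f' \<in> H" "f' \<notin> C" "v \<in> f'" using assms(4) by blast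
  moreover have "v \<notin> {v. incident H v = C}" using assms(4) by blast
  ultimately have "hdegree H v < hdegree E z"
    using outgoing_hdegree_less[OF end_zy class_props(1,2,4,3,5)[OF assms(1)], of v f f'] assms
      class_props(5)[OF assms(1)]
    by blast
  thus ?thesis by (simp add: s_def)
qed

lemma hyperedge_class:
  assumes "C \<in> classes" shows "hyperedge_class H C (k - 1) r s"
proof
  show "finite H" by (rule fin_H)
  show "C \<subseteq> H" "card C = k - 1" using class_props[OF assms] by blast+
  show "2 \<le> k - 1" "0 < r" using k_ge_3 r_ge_3 by auto
  show "2 * s \<le> k - 1" by (rule two_s)
  show "finite f" "card f = r" if "f \<in> C" for f
    using that class_props(1)[OF assms] fin_hyperedge hyperedge_card by blast+
  show "hdegree H v \<le> s" if "f \<in> C" "v \<in> f" "\<not> incident H v \<subseteq> C" for f v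
    by (rule outgoing_le[OF assms that])
qed

lemma total_weight: "(\<Sum>f\<in>H. hweight H f) = card {v \<in> X. 0 < hdegree H v}"
proof -
  have "(\<Sum>f\<in>H. hweight H f) = (\<Sum>v\<in>X. real (hdegree H v) / real (hdegree H v))"
    by (rule sum_hweight) (use fin_X fin_H hyperedge_subset in auto)
  also have "\<dots> = (\<Sum>v\<in>X. if 0 < hdegree H v then 1 else 0)"
    by (intro sum.cong) auto
  also have "\<dots> = card {v \<in> X. 0 < hdegree H v}"
    using fin_X by (simp add: sum.If_cases Int_def conj_commute)
  finally show ?thesis .
qed

lemma core_weight:
  shows "real (card classes) * real (r + 1) \<le> (\<Sum>f\<in>max_core. hweight H f)"
    and "card max_core = card classes * (k - 1)"
    and "(\<Sum>f\<in>max_core. hweight H f) = real (card classes) * real (r + 1) \<Longrightarrow>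
      C \<in> classes \<Longrightarrow> (\<Sum>f\<in>C. hweight H f) = real (r + 1)"
proof -
  have fin: "finite classes"
    by (rule finite_subset[of _ "Pow H"]) (use class_props(1) fin_H in auto)
  have finC: "\<forall>C\<in>classes. finite C" using class_props(1) fin_H finite_subset by blast
  have disj: "\<forall>A\<in>classes. \<forall>B\<in>classes. A \<noteq> B \<longrightarrow> A \<inter> B = {}"
    using classes_disjoint by blast
  have sum: "(\<Sum>f\<in>max_core. hweight H f) = (\<Sum>C\<in>classes. \<Sum>f\<in>C. hweight H f)"
    using sum.Union_disjoint[OF finC disj, of "hweight H"] Union_classes by simp
  have le: "real (r + 1) \<le> (\<Sum>f\<in>C. hweight H f)" if "C \<in> classes" for C
    using hyperedge_class.class_weight(1)[OF hyperedge_class[OF that]] .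
  show "real (card classes) * real (r + 1) \<le> (\<Sum>f\<in>max_core. hweight H f)"
    using sum_mono[of classes, OF le] sum by simp
  show "card max_core = card classes * (k - 1)"
  proof -
    have "card (\<Union>classes) = (\<Sum>C\<in>classes. card C)"
      by (rule card_Union_disjoint) (use disj finC in \<open>auto simp: pairwise_def disjnt_def\<close>)
    thus ?thesis using Union_classes class_props(2) by simp
  qed
  assume tight: "(\<Sum>f\<in>max_core. hweight H f) = real (card classes) * real (r + 1)"
    and C: "C \<in> classes"
  have "real (r + 1) = (\<Sum>f\<in>C. hweight H f)"
    by (rule sum_mono_equal[of classes "\<lambda>_. real (r + 1)", OF fin le _ C])
       (use tight sum in simp_all)
  thus "(\<Sum>f\<in>C. hweight H f) = real (r + 1)" by simp
qed

text \<open>\<open>peeling_bound\<close> speaks of degrees outside the core, whereas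
  \<open>hweight\<close> divides by degrees in \<open>H\<close>. They agree at vertices off the
  core. A vertex on both sides is outgoing for a class, so its full degree is at most
  \<open>s \<le> k - 2\<close>, and dividing by \<open>k - 2\<close> instead only loses
  weight.\<close>

lemma outside_weight:
  assumes "H - max_core \<noteq> {}"
  shows "real (card (H - max_core)) * (real (r + 1) / real (k - 1))
    < (\<Sum>f\<in>H - max_core. hweight H f)"
proof -
  let ?G = "H - max_core"
  let ?q = "k - 2"
  have q: "0 < ?q" using k_ge_3 by simp
  have "(r - ?q) * card ?G < (\<Sum>v\<in>X. min (hdegree ?G v) ?q)"
    by (rule peeling_bound[OF fin_X q _ _ assms])
       (use r_ge_3 fin_H hyperedge_subset hyperedge_card outside_core_sparse in auto)
  hence less: "real ((r - ?q) * card ?G) < real (\<Sum>v\<in>X. min (hdegree ?G v) ?q)"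
    by (simp only: of_nat_less_iff)
  have "real (\<Sum>v\<in>X. min (hdegree ?G v) ?q) / real ?q
      = (\<Sum>v\<in>X. real (min (hdegree ?G v) ?q) / real ?q)"
    by (simp add: sum_divide_distrib)
  also have "\<dots> \<le> (\<Sum>v\<in>X. real (hdegree ?G v) / real (hdegree H v))"
  proof (rule sum_mono)
    fix v assume "v \<in> X"
    have le: "hdegree ?G v \<le> hdegree H v" using fin_H by (intro hdegree_mono) auto
    show "real (min (hdegree ?G v) ?q) / real ?q \<le> real (hdegree ?G v) / real (hdegree H v)"
    proof (cases "hdegree ?G v = 0")
      case False
      hence pos: "0 < hdegree H v" using le by simp
      show ?thesis
      proof (cases "hdegree ?G v = hdegree H v")
        case True
        thus ?thesis using pos q by simp
      next
        case ne: False
        have "\<exists>f\<in>max_core. v \<in> f"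
        proof (rule ccontr)
          assume "\<not> ?thesis"
          hence eq: "incident ?G v = incident H v" by blast
          have "hdegree ?G v = hdegree H v" unfolding hdegree_def eq by (rule refl)
          thus False using ne by contradiction
        qed
        then obtain f where f: "f \<in> max_core" "v \<in> f" by blast
        have "\<exists>g\<in>?G. v \<in> g"
        proof (rule ccontr)
          assume "\<not> ?thesis"
          hence eq: "incident ?G v = {}" by blast
          have "hdegree ?G v = 0" unfolding hdegree_def eq by simp
          thus False using False by contradiction
        qed
        then obtain g where g: "g \<in> ?G" "v \<in> g" by blast
        obtain C where C: "C \<in> classes" "f \<in> C" using f Union_classes by blast
        have "\<not> incident H v \<subseteq> C" using g C Union_classes by blast
        hence "hdegree H v \<le> s" by (rule outgoing_le[OF C f(2)])
        moreover have "s \<le> ?q" using two_s k_ge_3 by linarith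
        ultimately have "hdegree H v \<le> ?q" by simp
        hence "real (min (hdegree ?G v) ?q) / real ?q \<le> real (hdegree ?G v) / real ?q"
          by (intro divide_right_mono) auto
        also have "\<dots> \<le> real (hdegree ?G v) / real (hdegree H v)"
          using pos q \<open>hdegree H v \<le> ?q\<close> by (intro divide_left_mono) auto
        finally show ?thesis .
      qed
    qed simp
  qed
  also have "\<dots> = (\<Sum>f\<in>?G. hweight H f)"
    by (rule sum_hweight[symmetric]) (use fin_X fin_H hyperedge_subset in auto)
  finally have "real (\<Sum>v\<in>X. min (hdegree ?G v) ?q) / real ?q \<le> (\<Sum>f\<in>?G. hweight H f)" .
  moreover have "real ((r - ?q) * card ?G) / real ?q < real (\<Sum>v\<in>X. min (hdegree ?G v) ?q) / real ?q"
    using less q by (intro divide_strict_right_mono) auto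
  moreover have "real (card ?G) * (real (r + 1) / real (k - 1)) \<le> real ((r - ?q) * card ?G) / real ?q"
  proof -
    \<comment> \<open>With \<open>j = k - 2\<close>, cross-multiplication turns the comparison
      \<open>(r + 1) / (j + 1) \<le> (r - j) / j\<close> into \<open>(j + 2) * j \<le> r\<close>,
      the assumed lower bound on \<open>r\<close>.\<close>
    obtain j where j: "k = j + 2" using k_ge_3 using that[of "k - 2"] by simp
    have rj: "(j + 2) * j \<le> r" using r_ge j by simp
    have "1 * j \<le> (j + 2) * j" by (rule mult_le_mono1) simp
    hence jr: "j \<le> r" using rj by linarith
    have "real ((j + 2) * j) \<le> real r" using rj by (simp only: of_nat_le_iff)
    hence "real (r + 1) / real (j + 1) \<le> (real r - real j) / real j"
      using q j by (simp add: field_simps)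
    hence "real (card ?G) * (real (r + 1) / real (j + 1))
        \<le> real (card ?G) * ((real r - real j) / real j)" by (intro mult_left_mono) auto
    thus ?thesis using j jr by (simp add: of_nat_diff mult.commute)
  qed
  ultimately show ?thesis by linarith
qed

text \<open>\<open>card H\<close>, scaled by the average weight \<open>c\<close>, is at most the
  total weight, which is at most \<open>card X\<close>. Equality makes every estimate tight: the
  strict bound outside the core excludes hyperedges there, no vertex is isolated, and each class
  weighs exactly \<open>r + 1\<close>.\<close>

lemma card_bound: "real (card H) \<le> real (card X) * real (k - 1) / real (r + 1)"
  and card_tight: "real (card H) = real (card X) * real (k - 1) / real (r + 1) \<Longrightarrow>
    H = max_core \<and> (\<forall>v\<in>X. 0 < hdegree H v) \<and> card X = card classes * (r + 1) \<and>
    (\<forall>C\<in>classes. (\<Sum>f\<in>C. hweight H f) = real (r + 1))"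
proof -
  define R where "R = real (r + 1)"
  define c where "c = R / real (k - 1)"
  have k1: "0 < real (k - 1)" using k_ge_3 by simp
  have n: "(\<Sum>f\<in>H. hweight H f) \<le> real (card X)"
    using total_weight card_mono[OF fin_X, of "{v \<in> X. 0 < hdegree H v}"] by simp
  have split: "(\<Sum>f\<in>H. hweight H f)
      = (\<Sum>f\<in>H - max_core. hweight H f) + (\<Sum>f\<in>max_core. hweight H f)"
    by (rule sum.subset_diff[OF max_core_subset fin_H])
  have cH: "card H = card (H - max_core) + card max_core"
    using card_Diff_subset[OF fin_max_core max_core_subset]
      card_mono[OF fin_H max_core_subset] by simp
  have core: "real (card max_core) * c = real (card classes) * R"
    using core_weight(2) k1 by (simp add: c_def)
  have core_le: "real (card classes) * R \<le> (\<Sum>f\<in>max_core. hweight H f)"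
    unfolding R_def by (rule core_weight(1))
  have out: "real (card (H - max_core)) * c \<le> (\<Sum>f\<in>H - max_core. hweight H f)"
  proof (cases "H - max_core = {}")
    case True
    show ?thesis unfolding True by simp
  next
    case False
    thus ?thesis unfolding c_def R_def by (intro less_imp_le outside_weight)
  qed
  have cHc: "real (card H) * c = real (card (H - max_core)) * c + real (card max_core) * c"
    unfolding cH by (simp add: algebra_simps)
  have bound: "real (card H) * c \<le> (\<Sum>f\<in>H. hweight H f)"
    using cHc out core core_le split by linarith
  have conv: "real (card X) * real (k - 1) / real (r + 1) = real (card X) / c"
    by (simp add: c_def R_def)
  have cpos: "0 < c" using k1 by (simp add: c_def R_def)
  show "real (card H) \<le> real (card X) * real (k - 1) / real (r + 1)"
    unfolding conv using bound n cpos by (simp only: pos_le_divide_eq)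
  assume "real (card H) = real (card X) * real (k - 1) / real (r + 1)"
  hence tight: "real (card H) * c = real (card X)"
    unfolding conv using cpos by simp
  have E: "H - max_core = {}"
  proof (rule ccontr)
    assume "\<not> ?thesis"
    hence "real (card (H - max_core)) * c < (\<Sum>f\<in>H - max_core. hweight H f)"
      unfolding c_def R_def by (rule outside_weight)
    thus False using tight cHc core core_le split n by linarith
  qed
  hence H: "H = max_core" using max_core_subset by blast
  have all: "real (card {v \<in> X. 0 < hdegree H v}) = real (card X)"
    using total_weight bound n tight by linarith
  have "{v \<in> X. 0 < hdegree H v} = X"
    by (rule card_subset_eq[OF fin_X]) (use all in auto)
  hence iso: "\<forall>v\<in>X. 0 < hdegree H v" by blast
  have cw: "(\<Sum>f\<in>max_core. hweight H f) = real (card classes) * real (r + 1)"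
    using core H tight n core_le unfolding R_def by simp
  have "real (card X) = real (card classes * (r + 1))"
    using core H tight by (simp add: R_def algebra_simps)
  hence "card X = card classes * (r + 1)" by (simp only: of_nat_eq_iff)
  thus "H = max_core \<and> (\<forall>v\<in>X. 0 < hdegree H v) \<and> card X = card classes * (r + 1) \<and>
    (\<forall>C\<in>classes. (\<Sum>f\<in>C. hweight H f) = real (r + 1))"
    using H iso core_weight(3)[OF cw] by blast
qed

end

section \<open>Extremal hypergraphs\<close>

text \<open>Hyperedges are nonempty, so each lies in one block only. Thus there are
  \<open>card P * m\<close> hyperedges on \<open>card P * (r + 1)\<close> vertices.\<close>

lemma block_hypergraph_count:
  assumes "block_hypergraph r m V E" "0 < r"
  shows "card E * (r + 1) = card V * m"
proof -
  obtain P where P: "partition_on V P" "\<And>B. B \<in> P \<Longrightarrow> card B = r + 1"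
    "\<And>B. B \<in> P \<Longrightarrow> card {e \<in> E. e \<subseteq> B} = m" "\<And>e. e \<in> E \<Longrightarrow> \<exists>B\<in>P. e \<subseteq> B"
    and U: "uniform_hypergraph r V E"
    using assms(1) unfolding block_hypergraph_def by blast
  have finV: "finite V" and subV: "\<And>e. e \<in> E \<Longrightarrow> e \<subseteq> V" and ce: "\<And>e. e \<in> E \<Longrightarrow> card e = r"
    using U by (auto simp: uniform_hypergraph_def hypergraph_def)
  have finP: "finite P" by (rule finite_elements[OF finV P(1)])
  have VP: "V = \<Union>P" and disj: "disjoint P" using P(1) by (auto simp: partition_on_def)
  have finE: "finite E" by (rule finite_subset[of _ "Pow V"]) (use subV finV in auto)
  have finB: "finite B" if "B \<in> P" for B
    by (rule card_ge_0_finite) (use P(2)[OF that] in simp)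
  have "card V = (\<Sum>B\<in>P. card B)"
    unfolding VP by (rule card_Union_disjoint)
      (use disj finB in \<open>auto simp: disjoint_def pairwise_def disjnt_def\<close>)
  hence cV: "card V = card P * (r + 1)" using P(2) by simp
  have "(\<Sum>B\<in>P. card {e \<in> E. e \<subseteq> B}) = 1 * card E"
  proof (rule sum_multicount[OF finP finE], rule ballI)
    fix e assume e: "e \<in> E"
    obtain B where B: "B \<in> P" "e \<subseteq> B" using P(4)[OF e] by blast
    obtain a where a: "a \<in> e" using ce[OF e] assms(2) by (metis card.empty ex_in_conv less_numeral_extra(3))
    have "B' = B" if "B' \<in> P" "e \<subseteq> B'" for B'
      using disjointD[OF disj that(1) B(1)] a B that by blast
    hence "{B \<in> P. e \<subseteq> B} = {B}" using B by blast
    thus "card {B \<in> P. e \<subseteq> B} = 1" by simp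
  qed
  hence "card E = card P * m" using P(3) by simp
  thus ?thesis using cV by (simp add: algebra_simps)
qed

text \<open>Counting hyperedges by their set in \<open>\<A>\<close> and by their vertex in
  \<open>X\<close> gives \<open>card \<A> * m = card X * s\<close>, hence
  \<open>card X = 2 * card \<A>\<close>. Each member of \<open>\<A>\<close> thus accounts for
  \<open>(r - 1) + 2\<close> vertices and \<open>m\<close> hyperedges.\<close>

lemma regular_two_sided_count:
  assumes "regular_two_sided r s m V E" "2 * s = m" "0 < m" "2 \<le> r"
  shows "card E * (r + 1) = card V * m"
proof -
  obtain X \<A> where two: "two_sided_with r V E X \<A>"
    and dX: "\<And>x. x \<in> X \<Longrightarrow> hdegree E x = s" and dA: "\<And>v. v \<in> \<Union>\<A> \<Longrightarrow> hdegree E v = m"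
    and U: "uniform_hypergraph r V E"
    using assms(1) unfolding regular_two_sided_def by blast
  have V: "V = X \<union> \<Union>\<A>" and XA: "X \<inter> \<Union>\<A> = {}" and disj: "disjoint \<A>"
    and cA: "\<And>A. A \<in> \<A> \<Longrightarrow> card A = r - 1"
    and edge: "\<And>e. e \<in> E \<Longrightarrow> \<exists>x\<in>X. \<exists>A\<in>\<A>. e = {x} \<union> A"
    using two unfolding two_sided_with_def by blast+
  have finV: "finite V" and subV: "\<And>e. e \<in> E \<Longrightarrow> e \<subseteq> V"
    using U by (auto simp: uniform_hypergraph_def hypergraph_def)
  have finX: "finite X" using finV V by simp
  have finA: "finite \<A>" by (rule finite_subset[of _ "Pow V"]) (use V finV in auto)
  have finE: "finite E" by (rule finite_subset[of _ "Pow V"]) (use subV finV in auto)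
  have fin_el: "\<And>A. A \<in> \<A> \<Longrightarrow> finite A" using V finV by (meson Sup_upper finite_Un finite_subset)
  \<comment> \<open>A hyperedge meeting \<open>A\<close> contains it, so the degree of a single
    vertex of \<open>A\<close> counts the hyperedges built on \<open>A\<close>.\<close>
  have own: "A \<subseteq> e" if "e \<in> E" "A \<in> \<A>" "a \<in> A" "a \<in> e" for e A a
  proof -
    obtain x A0 where e: "x \<in> X" "A0 \<in> \<A>" "e = {x} \<union> A0" using edge \<open>e \<in> E\<close> by blast
    hence "a \<in> A0" using XA that by blast
    hence "A = A0" using disjointD[OF disj that(2) e(2)] that by blast
    thus ?thesis using e by blast
  qed
  have ne: "\<exists>a. a \<in> A" if "A \<in> \<A>" for A
  proof -
    have "0 < card A" using cA[OF that] assms(4) by simp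
    hence "A \<noteq> {}" by auto
    thus ?thesis by blast
  qed
  have "(\<Sum>A\<in>\<A>. card {e \<in> E. A \<subseteq> e}) = 1 * card E"
  proof (rule sum_multicount[OF finA finE], rule ballI)
    fix e assume e: "e \<in> E"
    obtain x A0 where A0: "x \<in> X" "A0 \<in> \<A>" "e = {x} \<union> A0" using edge[OF e] by blast
    have "A = A0" if A: "A \<in> \<A>" "A \<subseteq> e" for A
    proof -
      obtain a where "a \<in> A" using ne[OF A(1)] by blast
      hence "a \<in> A \<inter> A0" using A A0 XA by blast
      thus ?thesis using disjointD[OF disj A(1) A0(2)] by blast
    qed
    hence "{A \<in> \<A>. A \<subseteq> e} = {A0}" using A0 by blast
    thus "card {A \<in> \<A>. A \<subseteq> e} = 1" by simp
  qed
  moreover have "card {e \<in> E. A \<subseteq> e} = m" if A: "A \<in> \<A>" for A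
  proof -
    obtain a where a: "a \<in> A" using ne[OF A] by blast
    have eq: "{e \<in> E. A \<subseteq> e} = incident E a" using own[OF _ A a] a by blast
    show ?thesis using dA[of a] a A unfolding hdegree_def eq by blast
  qed
  ultimately have EA: "card E = card \<A> * m" by simp
  have "(\<Sum>x\<in>X. card {e \<in> E. x \<in> e}) = 1 * card E"
  proof (rule sum_multicount[OF finX finE], rule ballI)
    fix e assume e: "e \<in> E"
    obtain x A0 where "x \<in> X" "A0 \<in> \<A>" "e = {x} \<union> A0" using edge[OF e] by blast
    hence "{x \<in> X. x \<in> e} = {x}" using XA by blast
    thus "card {x \<in> X. x \<in> e} = 1" by simp
  qed
  hence EX: "card E = card X * s" using dX by (simp add: hdegree_def)
  have "s * card X = s * (2 * card \<A>)" using EA EX assms(2) by (simp add: ac_simps)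
  hence cX: "card X = 2 * card \<A>" using assms(2,3) by simp
  have "card (\<Union>\<A>) = (\<Sum>A\<in>\<A>. card A)"
    by (rule card_Union_disjoint) (use disj fin_el in \<open>auto simp: disjoint_def pairwise_def disjnt_def\<close>)
  hence "card (\<Union>\<A>) = card \<A> * (r - 1)" using cA by simp
  moreover have "card V = card X + card (\<Union>\<A>)"
    unfolding V by (rule card_Un_disjoint) (use finV V XA in auto)
  ultimately have "card V = card \<A> * (2 + (r - 1))" using cX by (simp add: distrib_left)
  hence "card V = card \<A> * (r + 1)" using assms(4) by simp
  thus ?thesis using EA by (simp add: algebra_simps)
qed

lemma block_two_sided_union_count:
  assumes "block_two_sided_union r m s m V E" "2 * s = m" "0 < m" "2 \<le> r"
  shows "card E * (r + 1) = card V * m"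
proof -
  obtain V1 V2 E1 E2 where V: "V = V1 \<union> V2" "V1 \<inter> V2 = {}" "E = E1 \<union> E2"
    and 1: "block_hypergraph r m V1 E1" and 2: "regular_two_sided r s m V2 E2"
    using assms(1) unfolding block_two_sided_union_def by blast
  have U: "uniform_hypergraph r V1 E1" "uniform_hypergraph r V2 E2"
    using 1 2 unfolding block_hypergraph_def regular_two_sided_def by blast+
  have finV: "finite V1" "finite V2" and sub: "E1 \<subseteq> Pow V1" "E2 \<subseteq> Pow V2"
    and ce: "\<And>e. e \<in> E1 \<Longrightarrow> card e = r"
    using U by (auto simp: uniform_hypergraph_def hypergraph_def)
  have finE: "finite E1" "finite E2" using sub finV finite_subset by blast+
  have "{} \<notin> E1" using ce assms(4) by force
  \<comment> \<open>The vertex sets are disjoint, so only an empty hyperedge could be counted in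
    both parts.\<close>
  moreover have "e = {}" if "e \<in> E1" "e \<in> E2" for e using that sub V(2) by blast
  ultimately have "E1 \<inter> E2 = {}" by blast
  hence "card E = card E1 + card E2" "card V = card V1 + card V2"
    using V finV finE by (simp_all add: card_Un_disjoint)
  thus ?thesis
    using block_hypergraph_count[OF 1] regular_two_sided_count[OF 2 assms(2-4)] assms(4)
    by (simp add: add_mult_distrib)
qed

section \<open>Blocks and two-sided hypergraphs in the case of equality\<close>

context berge_free_end
begin

definition closed_classes :: "'a set set set" where
  "closed_classes = {C \<in> classes. card (\<Union>C) = r + 1 \<and> (\<forall>v\<in>\<Union>C. incident H v \<subseteq> C)}"

lemma uniform_sub:
  assumes "D \<subseteq> H" shows "uniform_hypergraph r (\<Union>D) D"
proof -
  have "\<Union>D \<subseteq> X" using assms hyperedge_subset by blast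
  hence "finite (\<Union>D)" using fin_X finite_subset by blast
  thus ?thesis
    using assms hyperedge_card by (auto simp: uniform_hypergraph_def hypergraph_def)
qed

lemma hyperedge_nonempty:
  assumes "f \<in> H" shows "\<exists>v. v \<in> f"
proof -
  have "0 < card f" using hyperedge_card[OF assms] r_ge_3 by simp
  hence "f \<noteq> {}" by auto
  thus ?thesis by blast
qed

lemma closed_classes_block:
  "block_hypergraph r (k - 1) (\<Union>(\<Union>closed_classes)) (\<Union>closed_classes)"
proof -
  have cl: "C \<in> classes" "card (\<Union>C) = r + 1" "\<And>v. v \<in> \<Union>C \<Longrightarrow> incident H v \<subseteq> C"
    if "C \<in> closed_classes" for C
    using that unfolding closed_classes_def by blast+
  have sub: "\<Union>closed_classes \<subseteq> H" using cl(1) class_props(1) by blast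
  define P where "P = Union ` closed_classes"
  have "partition_on (\<Union>(\<Union>closed_classes)) P"
  proof (rule partition_onI)
    show "\<Union>P = \<Union>(\<Union>closed_classes)" by (auto simp: P_def)
    show "{} \<notin> P"
    proof
      assume "{} \<in> P"
      then obtain C where "C \<in> closed_classes" "\<Union>C = {}" unfolding P_def by blast
      thus False using cl(2)[of C] by (metis Suc_eq_plus1 card.empty nat.distinct(1))
    qed
    fix p q assume pq: "p \<in> P" "q \<in> P" "p \<noteq> q"
    then obtain C D where CD: "C \<in> closed_classes" "D \<in> closed_classes" "p = \<Union>C" "q = \<Union>D"
      by (auto simp: P_def)
    have "C = D" if v: "v \<in> \<Union>C" "v \<in> \<Union>D" for v
    proof -
      obtain f where f: "f \<in> C" "v \<in> f" using v by blast
      hence "f \<in> H" using sub CD by blast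
      hence "f \<in> D" using cl(3)[OF CD(2) v(2)] f by blast
      thus ?thesis using classes_disjoint[OF cl(1)[OF CD(1)] cl(1)[OF CD(2)] f(1)] by blast
    qed
    thus "disjnt p q" using CD pq(3) by (auto simp: disjnt_def)
  qed
  moreover have "card B = r + 1 \<and> card {e \<in> \<Union>closed_classes. e \<subseteq> B} = k - 1" if B: "B \<in> P" for B
  proof -
    obtain C where C: "C \<in> closed_classes" "B = \<Union>C" using B by (auto simp: P_def)
    have "{e \<in> \<Union>closed_classes. e \<subseteq> B} = C"
    proof (intro equalityI subsetI)
      fix e assume e: "e \<in> {e \<in> \<Union>closed_classes. e \<subseteq> B}"
      hence eH: "e \<in> H" using sub by blast
      then obtain v where v: "v \<in> e" using hyperedge_nonempty by blast
      hence "v \<in> \<Union>C" using e C by blast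
      from cl(3)[OF C(1) this] show "e \<in> C" using eH v by blast
    qed (use C in blast)
    thus ?thesis using C cl class_props(2) by simp
  qed
  moreover have "\<forall>e\<in>\<Union>closed_classes. \<exists>B\<in>P. e \<subseteq> B" by (auto simp: P_def)
  ultimately show ?thesis
    unfolding block_hypergraph_def using uniform_sub[OF sub] by blast
qed

text \<open>The kernels become the sets of size \<open>r - 1\<close>; they are disjoint because the
  hyperedges at a vertex determine its class. The vertices of degree \<open>s\<close> form the other
  side, where petals of different classes may coincide. Closedness identifies degrees in
  \<open>\<Union>D\<close> with degrees in \<open>H\<close>.\<close>

lemma flower_classes_two_sided:
  assumes D: "D \<subseteq> classes" and closed: "\<And>v. v \<in> \<Union>(\<Union>D) \<Longrightarrow> incident H v \<subseteq> \<Union>D"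
    and flower: "\<And>C f. C \<in> D \<Longrightarrow> f \<in> C \<Longrightarrow>
      2 * s = k - 1 \<and> (\<exists>y. hdegree H y = s \<and> f = insert y {v. incident H v = C})"
  shows "regular_two_sided r s (k - 1) (\<Union>(\<Union>D)) (\<Union>D)"
proof -
  have sub: "\<Union>D \<subseteq> H" using D class_props(1) by blast
  have ne: "\<exists>f. f \<in> C" if "C \<in> D" for C
  proof -
    have "0 < card C" using class_props(2)[of C] that D k_ge_3 by auto
    hence "C \<noteq> {}" by auto
    thus ?thesis by blast
  qed
  have degA: "hdegree H v = k - 1" if "C \<in> D" "incident H v = C" for C v
    using class_props(2)[of C] that D by (auto simp: hdegree_def)
  \<comment> \<open>From \<open>2 * s = k - 1 > 0\<close> the two degrees differ, so degree alone
    separates petals from kernel vertices.\<close>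
  have s_ne: "s \<noteq> k - 1" if "C \<in> D" for C
    using flower[OF that] ne[OF that] k_ge_3 by fastforce
  have degD: "hdegree (\<Union>D) v = hdegree H v" if "v \<in> \<Union>(\<Union>D)" for v
  proof -
    have eq: "incident (\<Union>D) v = incident H v" using closed[OF that] sub by blast
    show ?thesis unfolding hdegree_def eq by (rule refl)
  qed
  define A where "A C = {v. incident H v = C}" for C
  define Y where "Y = {v \<in> \<Union>(\<Union>D). hdegree H v = s}"
  have AC: "A C \<subseteq> \<Union>(\<Union>D)" if C: "C \<in> D" for C
  proof -
    obtain f where f: "f \<in> C" using ne[OF C] by blast
    have "A C \<subseteq> f" using f unfolding A_def by blast
    thus ?thesis using f C by blast
  qed
  have fl: "\<exists>y\<in>Y. f = {y} \<union> A C" if C: "C \<in> D" "f \<in> C" for C f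
  proof -
    obtain y where y: "hdegree H y = s" "f = insert y {v. incident H v = C}"
      using flower[OF C] by blast
    hence "y \<in> Y" using C unfolding Y_def by blast
    thus ?thesis using y unfolding A_def by blast
  qed
  have YA: "Y \<inter> \<Union>(A ` D) = {}" using degA s_ne unfolding Y_def A_def by fastforce
  have "two_sided_with r (\<Union>(\<Union>D)) (\<Union>D) Y (A ` D)"
    unfolding two_sided_with_def
  proof (intro conjI)
    show "\<Union>(\<Union>D) = Y \<union> \<Union>(A ` D)"
    proof (intro equalityI subsetI)
      fix v assume "v \<in> \<Union>(\<Union>D)"
      then obtain C f where "C \<in> D" "f \<in> C" "v \<in> f" by blast
      thus "v \<in> Y \<union> \<Union>(A ` D)" using fl by blast
    next
      fix v assume "v \<in> Y \<union> \<Union>(A ` D)"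
      thus "v \<in> \<Union>(\<Union>D)" using AC unfolding Y_def by blast
    qed
    show "Y \<inter> \<Union>(A ` D) = {}" by (rule YA)
    show "disjoint (A ` D)" unfolding A_def by (rule disjointI) blast
    show "\<forall>B\<in>A ` D. card B = r - 1"
    proof
      fix B assume "B \<in> A ` D"
      then obtain C where C: "C \<in> D" "B = A C" by blast
      obtain f where f: "f \<in> C" using ne[OF C(1)] by blast
      then obtain y where y: "y \<in> Y" "f = {y} \<union> A C" using fl[OF C(1)] by blast
      have "y \<notin> A C" using y YA C by blast
      moreover have "card f = r" "finite f" using f C sub hyperedge_card fin_hyperedge by blast+
      ultimately show "card B = r - 1" using y C by simp
    qed
    show "\<forall>e\<in>\<Union>D. \<exists>x\<in>Y. \<exists>B\<in>A ` D. e = {x} \<union> B"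
    proof
      fix e assume "e \<in> \<Union>D"
      then obtain C where C: "C \<in> D" "e \<in> C" by blast
      obtain y where "y \<in> Y" "e = {y} \<union> A C" using fl[OF C] by blast
      thus "\<exists>x\<in>Y. \<exists>B\<in>A ` D. e = {x} \<union> B" using C(1) by (intro bexI[of _ y] bexI[of _ "A C"]) auto
    qed
  qed
  moreover have "\<forall>x\<in>Y. hdegree (\<Union>D) x = s" using degD by (simp add: Y_def)
  moreover have "\<forall>v\<in>\<Union>(A ` D). hdegree (\<Union>D) v = k - 1"
  proof
    fix v assume "v \<in> \<Union>(A ` D)"
    then obtain C where C: "C \<in> D" "v \<in> A C" by blast
    hence "v \<in> \<Union>(\<Union>D)" using AC by blast
    thus "hdegree (\<Union>D) v = k - 1" using degD degA[OF C(1)] C(2) by (simp add: A_def)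
  qed
  ultimately show ?thesis
    unfolding regular_two_sided_def using uniform_sub[OF sub] by blast
qed

text \<open>At weight exactly \<open>r + 1\<close> each class is closed or a sunflower, and the
  classes that are not closed make up the two-sided part. A sunflower forces
  \<open>2 * s = k - 1\<close>; otherwise only blocks remain.\<close>

lemma extremal_structure:
  assumes tight: "real (card H) = real (card X) * real (k - 1) / real (r + 1)"
  shows "(r + 1) dvd card X" "block_two_sided_union r (k - 1) s (k - 1) X H"
    and "2 * s \<noteq> k - 1 \<Longrightarrow> block_hypergraph r (k - 1) X H"
proof -
  from card_tight[OF tight] have H: "H = max_core" and iso: "\<forall>v\<in>X. 0 < hdegree H v"
    and cX: "card X = card classes * (r + 1)"
    and w: "\<forall>C\<in>classes. (\<Sum>f\<in>C. hweight H f) = real (r + 1)" by blast+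
  show "(r + 1) dvd card X" unfolding cX by (rule dvd_triv_right)
  define D where "D = classes - closed_classes"
  have HU: "H = \<Union>closed_classes \<union> \<Union>D"
    using H Union_classes unfolding D_def closed_classes_def by blast
  have XU: "X = \<Union>H"
  proof (intro equalityI subsetI)
    fix v assume "v \<in> X"
    hence "0 < card (incident H v)" using iso by (simp add: hdegree_def)
    hence "incident H v \<noteq> {}" by (metis card.empty less_numeral_extra(3))
    thus "v \<in> \<Union>H" by blast
  qed (use hyperedge_subset in blast)
  have flower: "2 * s = k - 1 \<and> (\<exists>y. hdegree H y = s \<and> f = insert y {v. incident H v = C})"
    if C: "C \<in> D" and f: "f \<in> C" for C f
  proof -
    have Cc: "C \<in> classes" "C \<notin> closed_classes" using C by (auto simp: D_def)
    interpret cls: hyperedge_class H C "k - 1" r s by (rule hyperedge_class[OF Cc(1)])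
    have "\<not> cls.closed_block"
      using Cc unfolding cls.closed_block_def closed_classes_def by blast
    hence "cls.sunflower" using cls.class_weight(2) w Cc by blast
    thus ?thesis using f unfolding cls.sunflower_def by blast
  qed
  \<comment> \<open>A closed class owns all hyperedges at its vertices, so no other class reaches
    them. This makes the block part and the two-sided part vertex-disjoint.\<close>
  have sep: "C = C'" if C: "C \<in> closed_classes" "C' \<in> classes" "v \<in> \<Union>C" "v \<in> \<Union>C'" for C C' v
  proof -
    obtain f where f: "f \<in> C'" "v \<in> f" using C(4) by blast
    have "f \<in> H" using f(1) class_props(1)[OF C(2)] by blast
    moreover have "incident H v \<subseteq> C" using C(1,3) unfolding closed_classes_def by blast
    ultimately have "f \<in> C" using f by blast
    moreover have "C \<in> classes" using C(1) by (simp add: closed_classes_def)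
    ultimately show ?thesis using classes_disjoint C(2) f(1) by blast
  qed
  have disj: "\<Union>(\<Union>closed_classes) \<inter> \<Union>(\<Union>D) = {}"
  proof (rule ccontr)
    assume "\<not> ?thesis"
    then obtain v C C' where "C \<in> closed_classes" "C' \<in> D" "v \<in> \<Union>C" "v \<in> \<Union>C'" by blast
    thus False using sep[of C C' v] unfolding D_def by blast
  qed
  have "incident H v \<subseteq> \<Union>D" if "v \<in> \<Union>(\<Union>D)" for v
    using that disj HU by blast
  hence "regular_two_sided r s (k - 1) (\<Union>(\<Union>D)) (\<Union>D)"
    using flower by (intro flower_classes_two_sided) (auto simp: D_def)
  moreover have "X = \<Union>(\<Union>closed_classes) \<union> \<Union>(\<Union>D)" using XU HU by blast
  ultimately show "block_two_sided_union r (k - 1) s (k - 1) X H"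
    unfolding block_two_sided_union_def using disj HU closed_classes_block by blast
  show "block_hypergraph r (k - 1) X H" if "2 * s \<noteq> k - 1"
  proof -
    have "C = {}" if "C \<in> D" for C using flower[OF that] \<open>2 * s \<noteq> k - 1\<close> by blast
    hence D0: "\<Union>D = {}" by blast
    have H0: "\<Union>closed_classes = H" using HU unfolding D0 by (simp only: Un_empty_right)
    show ?thesis using closed_classes_block unfolding H0 XU[symmetric] .
  qed
qed

end

text \<open>The vertex type is arbitrary here, so the result serves both the extremal number,
  defined on \<open>{..<n}\<close>, and the hypergraphs over any type in the theorem.\<close>

lemma berge_free_extremal:
  fixes n k r :: nat and VT :: "'v set" and ET :: "'v set set"
    and V :: "'a set" and E :: "'a set set"
  assumes T: "tree VT ET" "card ET = k" "k > 0" "\<not> star VT ET" and r: "k * (k - 2) \<le> r"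
    and E: "uniform_hypergraph r V E" "\<not> contains_berge V E VT ET"
  shows "real (card E) \<le> real (card V) * (real k - 1) / (real r + 1)"
    and "real (card E) = real (card V) * (real k - 1) / (real r + 1) \<longleftrightarrow>
      (r + 1) dvd card V \<and>
      (if odd k \<and> balanced_double_star ((k - 1) div 2) VT ET
       then block_two_sided_union r (k - 1) ((k - 1) div 2) (k - 1) V E
       else block_hypergraph r (k - 1) V E)" (is "?eq \<longleftrightarrow> _ \<and> ?str")
proof -
  interpret berge_free VT ET k r V E
    by unfold_locales (use assms in auto)
  obtain z y where zy: "end_vertex z y"
    and deg: "2 * hdegree ET z \<le> k \<or>
      2 * hdegree ET z = k + 1 \<and> balanced_double_star ((k - 1) div 2) VT ET"
    using small_end_vertex by metis
  interpret berge_free_end VT ET k r V E z y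
    by unfold_locales (use zy deg in auto)
  have z2: "2 \<le> hdegree ET z" using end_vertexD(5)[OF zy] .
  have conv: "real (card V) * (real k - 1) / (real r + 1)
      = real (card V) * real (k - 1) / real (r + 1)"
    using k_ge_3 by (simp add: of_nat_diff)
  show "real (card E) \<le> real (card V) * (real k - 1) / (real r + 1)"
    unfolding conv by (rule card_bound)
  have counted: ?eq if "card E * (r + 1) = card V * (k - 1)"
  proof -
    have "real (card E) * real (r + 1) = real (card V) * real (k - 1)"
      using that by (simp only: of_nat_mult[symmetric])
    thus ?thesis unfolding conv by (simp add: field_simps)
  qed
  show "?eq \<longleftrightarrow> (r + 1) dvd card V \<and> ?str"
  proof
    assume ?eq
    note tight = this[unfolded conv]
    have "?str"
    proof (cases "odd k \<and> balanced_double_star ((k - 1) div 2) VT ET")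
      case True
      show ?thesis
      proof (cases "2 * s = k - 1")
        case s: True
        hence "(k - 1) div 2 = s" by simp
        thus ?thesis using True extremal_structure(2)[OF tight] by simp
      next
        case False
        have "block_hypergraph r (k - 1) V E" by (rule extremal_structure(3)[OF tight False])
        \<comment> \<open>Only blocks occur here; the empty hypergraph on no vertices supplies the
          two-sided part of the union.\<close>
        moreover have "regular_two_sided r ((k - 1) div 2) (k - 1) ({} :: 'a set) {}"
          unfolding regular_two_sided_def two_sided_with_def uniform_hypergraph_def hypergraph_def
          by (auto intro!: exI[of _ "{}"])
        ultimately have "block_two_sided_union r (k - 1) ((k - 1) div 2) (k - 1) V E"
          unfolding block_two_sided_union_def by (metis Int_empty_right Un_empty_right)
        thus ?thesis using True by simp
      qed
    next
      case False
      \<comment> \<open>Equality would mean \<open>2 * hdegree ET z = k + 1\<close>, which the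
        choice of \<open>z\<close> permits only when the tree is the balanced double star.\<close>
      have "2 * s \<noteq> k - 1"
      proof
        assume "2 * s = k - 1"
        hence "2 * hdegree ET z = k + 1" using z2 k_ge_3 unfolding s_def by linarith
        moreover from this have "odd k" by presburger
        ultimately show False using deg False by simp
      qed
      hence "block_hypergraph r (k - 1) V E" by (rule extremal_structure(3)[OF tight])
      thus ?thesis unfolding if_not_P[OF False] .
    qed
    thus "(r + 1) dvd card V \<and> ?str" using extremal_structure(1)[OF tight] by blast
  next
    assume "(r + 1) dvd card V \<and> ?str"
    hence str: ?str by blast
    show ?eq
    proof (rule counted, cases "odd k \<and> balanced_double_star ((k - 1) div 2) VT ET")
      case True
      have "odd k" using True by blast
      hence even: "2 * ((k - 1) div 2) = k - 1" by presburger
      have "block_two_sided_union r (k - 1) ((k - 1) div 2) (k - 1) V E"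
        using str unfolding if_P[OF True] .
      thus "card E * (r + 1) = card V * (k - 1)"
        by (rule block_two_sided_union_count[OF _ even]) (use k_ge_3 r_ge_3 in auto)
    next
      case False
      have "block_hypergraph r (k - 1) V E" using str unfolding if_not_P[OF False] .
      thus "card E * (r + 1) = card V * (k - 1)"
        by (rule block_hypergraph_count) (use r_ge_3 in simp)
    qed
  qed
qed

lemma ex_berge_attained:
  assumes "ET \<noteq> {}"
  obtains E where "uniform_hypergraph r {..<n} E" "\<not> contains_berge {..<n} E VT ET"
    "card E = ex_berge r n VT ET"
proof -
  let ?S = "{card E | E. uniform_hypergraph r {..<n} E \<and> \<not> contains_berge {..<n} E VT ET}"
  have "\<not> contains_berge {..<n} {} VT ET"
    using assms by (auto simp: contains_berge_def berge_copy_def bij_betw_def)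
  hence "card ({} :: nat set set) \<in> ?S"
    by (intro CollectI exI[of _ "{}"]) (auto simp: uniform_hypergraph_def hypergraph_def)
  hence ne: "?S \<noteq> {}" by blast
  have "?S \<subseteq> card ` Pow (Pow {..<n})"
    by (auto simp: uniform_hypergraph_def hypergraph_def)
  hence "finite ?S" by (rule finite_subset) simp
  hence "ex_berge r n VT ET \<in> ?S" unfolding ex_berge_def using ne by (rule Max_in)
  thus thesis using that by auto
qed

theorem theorem4:
  fixes n k r :: nat and VT :: "'v set" and ET :: "'v set set"
  assumes "n > 0" and "k > 0" and "r > 0"
    and "tree VT ET" and "card ET = k" and "\<not> star VT ET"
    and "r \<ge> k * (k - 2)"
  shows "real (ex_berge r n VT ET) \<le> real n * (real k - 1) / (real r + 1) \<and>
    (\<forall>(V :: 'a set) E. uniform_hypergraph r V E \<and> card V = n \<and> \<not> contains_berge V E VT ET \<longrightarrow>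
       real (card E) \<le> real n * (real k - 1) / (real r + 1) \<and>
       (real (card E) = real n * (real k - 1) / (real r + 1) \<longleftrightarrow>
          (r + 1) dvd n \<and>
          (if odd k \<and> balanced_double_star ((k - 1) div 2) VT ET
           then block_two_sided_union r (k - 1) ((k - 1) div 2) (k - 1) V E
           else block_hypergraph r (k - 1) V E)))"
proof (intro conjI allI impI)
  have T: "tree VT ET" "card ET = k" "k > 0" "\<not> star VT ET" and r: "k * (k - 2) \<le> r"
    using assms by auto
  have "ET \<noteq> {}" using assms by auto
  then obtain E0 where E0: "uniform_hypergraph r {..<n} E0" "\<not> contains_berge {..<n} E0 VT ET"
    "card E0 = ex_berge r n VT ET"
    by (rule ex_berge_attained)
  show "real (ex_berge r n VT ET) \<le> real n * (real k - 1) / (real r + 1)"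
    using berge_free_extremal(1)[OF T r E0(1,2)] E0(3) by simp
  fix V :: "'a set" and E
  assume "uniform_hypergraph r V E \<and> card V = n \<and> \<not> contains_berge V E VT ET"
  hence V: "uniform_hypergraph r V E" "\<not> contains_berge V E VT ET" "card V = n" by auto
  show "real (card E) \<le> real n * (real k - 1) / (real r + 1)"
    using berge_free_extremal(1)[OF T r V(1,2)] V(3) by simp
  show "real (card E) = real n * (real k - 1) / (real r + 1) \<longleftrightarrow>
      (r + 1) dvd n \<and>
      (if odd k \<and> balanced_double_star ((k - 1) div 2) VT ET
       then block_two_sided_union r (k - 1) ((k - 1) div 2) (k - 1) V E
       else block_hypergraph r (k - 1) V E)"
    using berge_free_extremal(2)[OF T r V(1,2)] unfolding V(3) .
qed

end
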